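(* Let $\Omega=[-1,1]^2$. The eigenvalue problem (based on the regularizer $R_3$) $$\text{(A)}\quad \Delta^2u=\mu u\ \text{ in }\Omega,\qquad \partial_\nu u=0\ \text{ and }\ \tau^T\partial_\tau(\mathrm{H}u\,\nu)+\partial_\nu\Delta u=0\ \text{ on }\partial\Omega$$ has the same solutions as the eigenvalue problem (based on the regularizer $R_2$) $$\text{(B)}\quad \Delta^2u=\mu u\ \text{ in }\Omega,\qquad \partial_\nu u=0\ \text{ and }\ \partial_\nu\Delta u=0\ \text{ on }\partial\Omega,$$ namely the cosine basis $$u_m(x,y)=c_m\cos\Bigl(\frac{\pi m_1}{2}(x+1)\Bigr)\cos\Bigl(\frac{\pi m_2}{2}(y+1)\Bigr),\qquad m=(m_1,m_2)\in\mathbb{N}_0^2 .$$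
   Context: Here $u:\Omega\to\mathbb{R}$ is scalar-valued, $\Delta$ is the Laplacian and $\Delta^2$ the Bi-Laplacian in two variables, and $\mathrm{H}u$ is the $2\times2$ Hessian matrix of $u$. $\nu$ is the exterior normal to $\partial\Omega$, $\tau$ is the normalized tangent vector to $\partial\Omega$ such that the system $\{\tau,\nu\}$ is positively oriented, and $\partial_\nu,\partial_\tau$ are the derivatives in the directions $\nu,\tau$. The constants $c_m$ are such that the $L^2$-norm of $u_m$ on $\Omega$ equals $1$, and $\mathbb{N}_0=\{0,1,2,\dots\}$. The regularizers are $R_2[u]=\frac{1}{2|\Omega|}\int_\Omega|\Delta u|^2\,dx$ and $R_3[u]=\frac{1}{2|\Omega|}\int_\Omega|\mathrm{H}u|_F^2\,dx$, with $|\cdot|_F$ the Frobenius norm; problems (B) and (A) arise from $R_2$ and $R_3$, respectively, by the calculus of variations when the boundary condition $\partial_\nu u=0$ is enforced and the remaining boundary condition is the natural one. *)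

theory Defs
  imports "HOL-Analysis.Analysis"
begin

definition Omega :: "(real^2) set" where
  "Omega = cbox (vector [-1, -1]) (vector [1, 1])"

(* The derivative is taken within S, so at a boundary point of the closed square it is the one-sided
   derivative from inside, and it only depends on f restricted to S.  It is uniquely determined when
   S is open or a nondegenerate box, and, for v tangent to S, when S is a smooth arc near z. *)
definition dir_deriv ::
    "'a::real_normed_vector set \<Rightarrow> ('a \<Rightarrow> 'b::real_normed_vector) \<Rightarrow> 'a \<Rightarrow> 'a \<Rightarrow> 'b" where
  "dir_deriv S f v z = frechet_derivative f (at z within S) v"

(* C^k up to those boundary points that belong to S. *)
primrec C_k :: "nat \<Rightarrow> 'a::real_normed_vector set \<Rightarrow> ('a \<Rightarrow> 'b::real_normed_vector) \<Rightarrow> bool" where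
  "C_k 0 S f \<longleftrightarrow> continuous_on S f"
| "C_k (Suc k) S f \<longleftrightarrow> f differentiable_on S \<and> (\<forall>v. C_k k S (dir_deriv S f v))"

definition laplacian :: "(real^2) set \<Rightarrow> (real^2 \<Rightarrow> real) \<Rightarrow> real^2 \<Rightarrow> real" where
  "laplacian S u z = (\<Sum>i\<in>UNIV. dir_deriv S (dir_deriv S u (axis i 1)) (axis i 1) z)"

definition bilaplacian :: "(real^2) set \<Rightarrow> (real^2 \<Rightarrow> real) \<Rightarrow> real^2 \<Rightarrow> real" where
  "bilaplacian S u = laplacian S (laplacian S u)"

definition hessian :: "(real^2) set \<Rightarrow> (real^2 \<Rightarrow> real) \<Rightarrow> real^2 \<Rightarrow> real^2^2" where
  "hessian S u z = (\<chi> i j. dir_deriv S (dir_deriv S u (axis j 1)) (axis i 1) z)"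

(* For a convex body S: all unit outer normals of supporting lines of S at z.
   At a corner there are many of them. *)
definition exterior_normals :: "(real^2) set \<Rightarrow> real^2 \<Rightarrow> (real^2) set" where
  "exterior_normals S z = {n. norm n = 1 \<and> (\<forall>x\<in>S. (x - z) \<bullet> n \<le> 0)}"

(* The boundary points at which the exterior normal is well defined; for the square these are all
   boundary points except the four corners. *)
definition smooth_boundary :: "(real^2) set \<Rightarrow> (real^2) set" where
  "smooth_boundary S = {z \<in> frontier S. \<exists>n. exterior_normals S z = {n}}"

definition normal :: "(real^2) set \<Rightarrow> real^2 \<Rightarrow> real^2" where
  "normal S z = (THE n. n \<in> exterior_normals S z)"

definition tangent :: "(real^2) set \<Rightarrow> real^2 \<Rightarrow> real^2" where
  "tangent S z = vector [normal S z $ 2, - (normal S z $ 1)]"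

lemma tangent_positively_oriented:
  assumes "norm (normal S z) = 1"
  shows "norm (tangent S z) = 1" "tangent S z \<bullet> normal S z = 0"
    and "det (vector [tangent S z, normal S z] :: real^2^2) = 1"
  using assms
  by (auto simp: tangent_def norm_vec_def L2_set_def inner_vec_def sum_2 det_2 power2_eq_square
      add.commute)

(* Classical solutions: C^4 inside, C^3 up to the boundary, which is what the third order boundary
   conditions need.  The boundary conditions are imposed wherever the normal exists.
   In the first term of the third order condition of (A), the field Hu \<nu> lives on the boundary
   curve, since \<nu> does; hence the derivative within frontier S. *)
definition solves_A :: "(real^2) set \<Rightarrow> real \<Rightarrow> (real^2 \<Rightarrow> real) \<Rightarrow> bool" where
  "solves_A S \<mu> u \<longleftrightarrow>
     C_k 4 (interior S) u \<and> C_k 3 S u \<and>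
     (\<forall>z\<in>interior S. bilaplacian S u z = \<mu> * u z) \<and>
     (\<forall>z\<in>smooth_boundary S.
        dir_deriv S u (normal S z) z = 0 \<and>
        tangent S z \<bullet> dir_deriv (frontier S) (\<lambda>x. hessian S u x *v normal S x) (tangent S z) z
          + dir_deriv S (laplacian S u) (normal S z) z = 0)"

definition solves_B :: "(real^2) set \<Rightarrow> real \<Rightarrow> (real^2 \<Rightarrow> real) \<Rightarrow> bool" where
  "solves_B S \<mu> u \<longleftrightarrow>
     C_k 4 (interior S) u \<and> C_k 3 S u \<and>
     (\<forall>z\<in>interior S. bilaplacian S u z = \<mu> * u z) \<and>
     (\<forall>z\<in>smooth_boundary S.
        dir_deriv S u (normal S z) z = 0 \<and>
        dir_deriv S (laplacian S u) (normal S z) z = 0)"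

definition eigenfunction_A :: "(real^2) set \<Rightarrow> real \<Rightarrow> (real^2 \<Rightarrow> real) \<Rightarrow> bool" where
  "eigenfunction_A S \<mu> u \<longleftrightarrow> solves_A S \<mu> u \<and> (\<exists>z\<in>S. u z \<noteq> 0)"

definition eigenfunction_B :: "(real^2) set \<Rightarrow> real \<Rightarrow> (real^2 \<Rightarrow> real) \<Rightarrow> bool" where
  "eigenfunction_B S \<mu> u \<longleftrightarrow> solves_B S \<mu> u \<and> (\<exists>z\<in>S. u z \<noteq> 0)"

definition square_integrable :: "(real^2) set \<Rightarrow> (real^2 \<Rightarrow> real) \<Rightarrow> bool" where
  "square_integrable S f \<longleftrightarrow>
     set_borel_measurable lebesgue S f \<and> set_integrable lebesgue S (\<lambda>z. (f z)\<^sup>2)"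

definition L2_inner :: "(real^2) set \<Rightarrow> (real^2 \<Rightarrow> real) \<Rightarrow> (real^2 \<Rightarrow> real) \<Rightarrow> real" where
  "L2_inner S f g = (LINT z:S|lebesgue. f z * g z)"

definition L2_norm :: "(real^2) set \<Rightarrow> (real^2 \<Rightarrow> real) \<Rightarrow> real" where
  "L2_norm S f = sqrt (L2_inner S f f)"

(* Orthonormal (Hilbert) basis of L^2(S): an orthonormal family with dense linear span. *)
definition orthonormal_basis :: "(real^2) set \<Rightarrow> ('i \<Rightarrow> real^2 \<Rightarrow> real) \<Rightarrow> bool" where
  "orthonormal_basis S e \<longleftrightarrow>
     (\<forall>i. square_integrable S (e i)) \<and>
     (\<forall>i j. L2_inner S (e i) (e j) = (if i = j then 1 else 0)) \<and>
     (\<forall>f \<epsilon>. square_integrable S f \<longrightarrow> \<epsilon> > 0 \<longrightarrow>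
        (\<exists>F a. finite F \<and> L2_norm S (\<lambda>z. f z - (\<Sum>i\<in>F. a i * e i z)) < \<epsilon>))"

definition cos_product :: "nat \<times> nat \<Rightarrow> real^2 \<Rightarrow> real" where
  "cos_product m z =
     cos (pi * real (fst m) / 2 * (z $ 1 + 1)) * cos (pi * real (snd m) / 2 * (z $ 2 + 1))"

definition cos_const :: "nat \<times> nat \<Rightarrow> real" where
  "cos_const m = 1 / L2_norm Omega (cos_product m)"

definition cos_basis :: "nat \<times> nat \<Rightarrow> real^2 \<Rightarrow> real" where
  "cos_basis m z = cos_const m * cos_product m z"

end

theory Submission
  imports Defs
begin

text \<open>
  On a side of the square the normal is constant, so the tangential component of the field
  $\mathrm{H}u\,\nu$ is $\partial_\tau\partial_\nu u$, which vanishes because $\partial_\nu u = 0$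
  along the side.  Hence (A) and (B) impose the same boundary conditions.  If $u$ solves (B), then
  $u$ and $\Delta u$ both satisfy a homogeneous Neumann condition, so two applications of Green's
  identity against a cosine product with $-\Delta$-eigenvalue $\lambda_m$ give
  $\mu\,\langle u, u_m\rangle = \lambda_m^2\,\langle u, u_m\rangle$.  Only the finitely many $m$ with
  $\lambda_m^2 = \mu$ survive, and a continuous function that is orthogonal to all cosine products
  vanishes by Stone--Weierstrass.
\<close>

subsection \<open>Derivatives within a set\<close>

text \<open>Regularity shapes the analysis. \<open>u\<close> is C^3 up to the boundary but C^4 only
  inside, so \<Delta>u is C^1 on the closed square while its second derivatives are controlled only
  in the interior; what extends continuously is their sum \<Delta>\<Delta>u = \<mu> u. Green's
  identity is therefore stated with continuous extensions of the two Laplacians as data. The corners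
  carry no normal and no boundary condition, and have to be discarded as a null set of the boundary
  integrals. The tangential term of (A) has an obstacle of its own: \<open>dir_deriv\<close> rests
  on a choice of Frechet derivative, and within the boundary curve such a derivative is determined
  only along the tangent. So existence must be shown, and the value must be read off along the side.
  The cosine products enter as Neumann eigenfunctions of -\<Delta>: with \<Delta>u_m = -\<lambda>_m
  u_m, the third order condition reduces to the first order one. As \<lambda>_m tends to infinity,
  each \<mu> meets finitely many m, so the expansion of an eigenfunction is a finite sum and raises
  no convergence question.\<close>

lemma Omega_iff: "z \<in> Omega \<longleftrightarrow> (\<forall>i. \<bar>z $ i\<bar> \<le> 1)"
  unfolding Omega_def mem_box_cart by (auto simp: forall_2 abs_le_iff)

lemma interior_Omega_iff: "z \<in> interior Omega \<longleftrightarrow> (\<forall>i. \<bar>z $ i\<bar> < 1)"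
  unfolding Omega_def interior_cbox mem_box_cart by (auto simp: forall_2 abs_less_iff)

lemma frontier_Omega: "frontier Omega = Omega - interior Omega"
  by (simp add: Omega_def frontier_cbox)

text \<open>\<open>frechet_derivative\<close> is a choice among all maps that qualify; this
  predicate says that on \<open>S\<close> the choice is forced, which is what the sum, product and
  scaling rules need. The codomain is fixed to \<open>real\<close> because a definition cannot
  quantify over types; every field differentiated by these rules is scalar.\<close>

definition unique_derivatives :: "'a::real_normed_vector set \<Rightarrow> bool" where
  "unique_derivatives S \<longleftrightarrow> (\<forall>z\<in>S. \<forall>(f::'a \<Rightarrow> real) f'.
     (f has_derivative f') (at z within S) \<longrightarrow> frechet_derivative f (at z within S) = f')"

lemma unique_derivatives_open: "open S \<Longrightarrow> unique_derivatives S"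
  unfolding unique_derivatives_def by (metis frechet_derivative_at at_within_open)

lemma unique_derivatives_Omega: "unique_derivatives Omega"
  unfolding unique_derivatives_def
proof (intro ballI allI impI)
  fix z :: "real^2" and f :: "real^2 \<Rightarrow> real" and f'
  assume "z \<in> Omega" "(f has_derivative f') (at z within Omega)"
  then show "frechet_derivative f (at z within Omega) = f'"
    unfolding Omega_def
  proof (intro frechet_derivative_within_cbox)
    fix b :: "real^2" assume "b \<in> Basis"
    then obtain i where "b = axis i 1" by (auto simp: Basis_vec_def)
    then show "vector [-1, -1] \<bullet> b < vector [1, 1] \<bullet> b"
      using exhaust_2[of i] by (auto simp: inner_axis)
  qed
qed

lemma dir_deriv_eqI:
  fixes f :: "'a::real_normed_vector \<Rightarrow> real"
  assumes "unique_derivatives S" "z \<in> S" "(f has_derivative f') (at z within S)"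
  shows "dir_deriv S f v z = f' v"
  using assms unfolding unique_derivatives_def dir_deriv_def by metis

lemma dir_deriv_works:
  assumes "f differentiable_on S" "z \<in> S"
  shows "(f has_derivative (\<lambda>v. dir_deriv S f v z)) (at z within S)"
  using assms unfolding dir_deriv_def differentiable_on_def by (simp add: frechet_derivative_works)

text \<open>Functions that agree on \<open>S\<close> have the same candidate derivatives within
  \<open>S\<close>, so the choice operator returns the same map for both, whatever \<open>S\<close>
  is. This lets identities valid only on \<open>S\<close> be used under
  \<open>dir_deriv\<close>.\<close>

lemma dir_deriv_cong:
  assumes "z \<in> S" "\<And>x. x \<in> S \<Longrightarrow> f x = g x"
  shows "dir_deriv S f v z = dir_deriv S g v z"
proof -
  have "(f has_derivative F) (at z within S) \<longleftrightarrow> (g has_derivative F) (at z within S)" for F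
    using assms by (metis has_derivative_transform)
  then show ?thesis
    by (simp add: dir_deriv_def frechet_derivative_def)
qed

lemma C_k_cong:
  assumes "\<And>x. x \<in> S \<Longrightarrow> f x = g x" "C_k k S f"
  shows "C_k k S g"
  using assms
proof (induction k arbitrary: f g)
  case 0
  then show ?case by (metis C_k.simps(1) continuous_on_cong)
next
  case (Suc k)
  have "g differentiable_on S"
    unfolding differentiable_on_def
  proof
    fix z assume "z \<in> S"
    then have "f differentiable at z within S" using Suc.prems(2) by (simp add: differentiable_on_def)
    then obtain F where "(f has_derivative F) (at z within S)" by (auto simp: differentiable_def)
    then have "(g has_derivative F) (at z within S)"
      by (rule has_derivative_transform[rotated 2]) (use \<open>z \<in> S\<close> Suc.prems(1) in simp_all)
    then show "g differentiable at z within S" by (auto simp: differentiable_def)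
  qed
  moreover have "C_k k S (dir_deriv S g v)" for v
  proof (rule Suc.IH)
    show "C_k k S (dir_deriv S f v)" using Suc.prems(2) by simp
    show "dir_deriv S f v x = dir_deriv S g v x" if "x \<in> S" for x
      using that Suc.prems(1) by (rule dir_deriv_cong)
  qed
  ultimately show ?case by simp
qed

lemma C_k_Suc_D: "C_k (Suc k) S f \<Longrightarrow> C_k k S f"
  by (induction k arbitrary: f) (auto intro: differentiable_imp_continuous_on)

lemma C_k_antimono: "k \<le> l \<Longrightarrow> C_k l S f \<Longrightarrow> C_k k S f"
  by (induction rule: inc_induct) (auto intro: C_k_Suc_D)

lemma dir_deriv_add:
  fixes f g :: "'a::real_normed_vector \<Rightarrow> real"
  assumes "unique_derivatives S" "z \<in> S" "f differentiable_on S" "g differentiable_on S"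
  shows "dir_deriv S (\<lambda>x. f x + g x) v z = dir_deriv S f v z + dir_deriv S g v z"
  by (rule dir_deriv_eqI[OF assms(1,2) has_derivative_add[OF dir_deriv_works dir_deriv_works]])
     (use assms in auto)

lemma dir_deriv_cmult:
  fixes f :: "'a::real_normed_vector \<Rightarrow> real"
  assumes "unique_derivatives S" "z \<in> S" "f differentiable_on S"
  shows "dir_deriv S (\<lambda>x. c * f x) v z = c * dir_deriv S f v z"
  by (rule dir_deriv_eqI[OF assms(1,2) has_derivative_mult_right[OF dir_deriv_works]])
     (use assms in auto)

lemma C_k_add:
  fixes f g :: "'a::real_normed_vector \<Rightarrow> real"
  assumes "unique_derivatives S" "C_k k S f" "C_k k S g"
  shows "C_k k S (\<lambda>x. f x + g x)"
  using assms(2,3)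
proof (induction k arbitrary: f g)
  case 0
  then show ?case by (auto intro: continuous_on_add)
next
  case (Suc k)
  then have "C_k k S (\<lambda>z. dir_deriv S f v z + dir_deriv S g v z)" for v by simp
  \<comment> \<open>The sum rule holds only at points of \<open>S\<close>; elsewhere the two
    functions may differ, hence the detour through \<open>C_k_cong\<close>.\<close>
  then have "C_k k S (dir_deriv S (\<lambda>x. f x + g x) v)" for v
    by (rule C_k_cong[rotated]) (use Suc.prems dir_deriv_add[OF assms(1)] in auto)
  then show ?case using Suc.prems by auto
qed

lemma C_k_cmult:
  fixes f :: "'a::real_normed_vector \<Rightarrow> real"
  assumes "unique_derivatives S" "C_k k S f"
  shows "C_k k S (\<lambda>x. c * f x)"
  using assms(2)
proof (induction k arbitrary: f)
  case 0
  then show ?case by (auto intro: continuous_on_mult_left)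
next
  case (Suc k)
  then have "C_k k S (\<lambda>z. c * dir_deriv S f v z)" for v by simp
  then have "C_k k S (dir_deriv S (\<lambda>x. c * f x) v)" for v
    by (rule C_k_cong[rotated]) (use Suc.prems dir_deriv_cmult[OF assms(1)] in auto)
  then show ?case using Suc.prems
    by (simp add: differentiable_on_def differentiable_cmult_left_iff differentiable_mult)
qed

lemma laplacian_2:
  "laplacian S u = (\<lambda>z. dir_deriv S (dir_deriv S u (axis 1 1)) (axis 1 1) z
     + dir_deriv S (dir_deriv S u (axis 2 1)) (axis 2 1) z)"
  by (simp add: laplacian_def sum_2 fun_eq_iff)

lemma C_k_2_D:
  assumes "C_k 2 S f"
  shows "f differentiable_on S" "dir_deriv S f v differentiable_on S"
  using assms by (simp_all add: numeral_2_eq_2)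

lemma C_k_laplacian:
  assumes "unique_derivatives S" "C_k (Suc (Suc k)) S u"
  shows "C_k k S (laplacian S u)"
  unfolding laplacian_2 using assms by (intro C_k_add) auto

lemma laplacian_cong:
  assumes "z \<in> S" "\<And>x. x \<in> S \<Longrightarrow> f x = g x"
  shows "laplacian S f z = laplacian S g z"
  unfolding laplacian_def
  by (intro sum.cong refl dir_deriv_cong assms) (simp_all add: assms)

lemma laplacian_add:
  assumes "unique_derivatives S" "z \<in> S" "C_k 2 S f" "C_k 2 S g"
  shows "laplacian S (\<lambda>x. f x + g x) z = laplacian S f z + laplacian S g z"
proof -
  have "dir_deriv S (dir_deriv S (\<lambda>x. f x + g x) v) v z =
      dir_deriv S (dir_deriv S f v) v z + dir_deriv S (dir_deriv S g v) v z" for v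
  proof -
    have "dir_deriv S (dir_deriv S (\<lambda>x. f x + g x) v) v z =
        dir_deriv S (\<lambda>x. dir_deriv S f v x + dir_deriv S g v x) v z"
      by (intro dir_deriv_cong dir_deriv_add assms C_k_2_D)
    also have "\<dots> = dir_deriv S (dir_deriv S f v) v z + dir_deriv S (dir_deriv S g v) v z"
      by (intro dir_deriv_add assms C_k_2_D)
    finally show ?thesis .
  qed
  then show ?thesis by (simp add: laplacian_2)
qed

lemma laplacian_cmult:
  assumes "unique_derivatives S" "z \<in> S" "C_k 2 S f"
  shows "laplacian S (\<lambda>x. c * f x) z = c * laplacian S f z"
proof -
  have "dir_deriv S (dir_deriv S (\<lambda>x. c * f x) v) v z =
      c * dir_deriv S (dir_deriv S f v) v z" for v
  proof -
    have "dir_deriv S (dir_deriv S (\<lambda>x. c * f x) v) v z =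
        dir_deriv S (\<lambda>x. c * dir_deriv S f v x) v z"
      by (rule dir_deriv_cong[OF assms(2)])
         (rule dir_deriv_cmult[OF assms(1) _ C_k_2_D(1)[OF assms(3)]])
    also have "\<dots> = c * dir_deriv S (dir_deriv S f v) v z"
      by (rule dir_deriv_cmult[OF assms(1,2) C_k_2_D(2)[OF assms(3)]])
    finally show ?thesis .
  qed
  then show ?thesis by (simp add: laplacian_2 distrib_left)
qed

text \<open>\<open>C_k 4\<close> is required within the open interior, while the equation uses
  derivatives within the closed set. At interior points the two filters coincide, so results for
  open sets carry over.\<close>

lemma dir_deriv_interior:
  "z \<in> interior S \<Longrightarrow> dir_deriv (interior S) f v z = dir_deriv S f v z"
  by (metis dir_deriv_def at_within_interior at_within_open open_interior)

lemma laplacian_interior: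
  assumes "z \<in> interior S"
  shows "laplacian (interior S) f z = laplacian S f z"
proof -
  have "dir_deriv (interior S) (dir_deriv (interior S) f v) v z
      = dir_deriv (interior S) (dir_deriv S f v) v z" for v
    by (intro dir_deriv_cong assms dir_deriv_interior)
  then show ?thesis
    by (simp add: laplacian_def dir_deriv_interior assms)
qed

lemma bilaplacian_interior:
  assumes "z \<in> interior S"
  shows "bilaplacian (interior S) f z = bilaplacian S f z"
proof -
  have "bilaplacian (interior S) f z = laplacian (interior S) (laplacian S f) z"
    unfolding bilaplacian_def using assms by (intro laplacian_cong) (auto simp: laplacian_interior)
  then show ?thesis using assms by (simp add: laplacian_interior bilaplacian_def)
qed

lemma bilaplacian_cong:
  assumes "z \<in> S" "\<And>x. x \<in> S \<Longrightarrow> f x = g x"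
  shows "bilaplacian S f z = bilaplacian S g z"
  unfolding bilaplacian_def using assms by (intro laplacian_cong) auto

lemma bilaplacian_add:
  assumes "unique_derivatives S" "z \<in> S" "C_k 4 S f" "C_k 4 S g"
  shows "bilaplacian S (\<lambda>x. f x + g x) z = bilaplacian S f z + bilaplacian S g z"
proof -
  have C2: "C_k 2 S f" "C_k 2 S g" using assms(3,4) by (auto intro: C_k_antimono[of 2 4])
  have "bilaplacian S (\<lambda>x. f x + g x) z = laplacian S (\<lambda>z. laplacian S f z + laplacian S g z) z"
    unfolding bilaplacian_def by (intro laplacian_cong laplacian_add assms C2)
  also have "\<dots> = bilaplacian S f z + bilaplacian S g z"
    unfolding bilaplacian_def
    by (intro laplacian_add C_k_laplacian) (use assms in \<open>auto simp: eval_nat_numeral\<close>)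
  finally show ?thesis .
qed

lemma bilaplacian_cmult:
  assumes "unique_derivatives S" "z \<in> S" "C_k 4 S f"
  shows "bilaplacian S (\<lambda>x. c * f x) z = c * bilaplacian S f z"
proof -
  have C2: "C_k 2 S f" using assms(3) by (auto intro: C_k_antimono[of 2 4])
  have "bilaplacian S (\<lambda>x. c * f x) z = laplacian S (\<lambda>z. c * laplacian S f z) z"
    unfolding bilaplacian_def
    by (rule laplacian_cong[OF assms(2)]) (rule laplacian_cmult[OF assms(1) _ C2])
  also have "\<dots> = c * bilaplacian S f z"
    unfolding bilaplacian_def
    by (intro laplacian_cmult C_k_laplacian) (use assms in \<open>auto simp: eval_nat_numeral\<close>)
  finally show ?thesis .
qed

subsection \<open>The boundary of the square\<close>

lemma norm_axis: "norm (axis i (x::real)) = \<bar>x\<bar>"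
  by (simp add: norm_eq_sqrt_inner inner_axis_axis)

lemma axis_in_exterior_normals_Omega:
  assumes "\<bar>z $ i\<bar> = 1"
  shows "axis i (z $ i) \<in> exterior_normals Omega z"
proof -
  have "(x $ i - z $ i) * z $ i \<le> 0" if "x \<in> Omega" for x
  proof -
    have "\<bar>x $ i\<bar> \<le> 1" using that by (simp add: Omega_iff)
    then show ?thesis using assms by (cases "z $ i \<ge> 0") auto
  qed
  then show ?thesis
    using assms by (auto simp: exterior_normals_def norm_axis inner_axis)
qed

text \<open>Sliding \<open>z\<close> along another axis in both directions stays in the square, so
  every other component of a normal vanishes; unit length and one test point then fix the remaining
  component and its sign.\<close>

lemma exterior_normal_Omega_unique:
  assumes z: "z \<in> Omega" "\<bar>z $ i\<bar> = 1" "\<And>j. j \<noteq> i \<Longrightarrow> \<bar>z $ j\<bar> < 1"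
  shows "exterior_normals Omega z = {axis i (z $ i)}"
proof (intro equalityI subsetI)
  fix n assume "n \<in> exterior_normals Omega z"
  then have n: "norm n = 1" and le: "\<And>x. x \<in> Omega \<Longrightarrow> (x - z) \<bullet> n \<le> 0"
    by (auto simp: exterior_normals_def)
  have nj: "n $ j = 0" if "j \<noteq> i" for j
  proof -
    define d where "d = 1 - \<bar>z $ j\<bar>"
    have d: "d > 0" using z(3)[OF that] by (simp add: d_def)
    have "z + axis j d \<in> Omega" "z + axis j (- d) \<in> Omega"
      using z(1) by (auto simp: Omega_iff axis_def d_def abs_le_iff) (smt (verit))+
    from this[THEN le] have "d * n $ j \<le> 0" "(-d) * n $ j \<le> 0"
      by (simp_all add: inner_axis')
    then show ?thesis using d
      by (auto simp: mult_le_0_iff zero_le_mult_iff)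
  qed
  have n_eq: "n = axis i (n $ i)"
    using nj by (auto simp: vec_eq_iff axis_def)
  have "\<bar>n $ i\<bar> = 1"
    using n by (subst (asm) n_eq) (simp add: norm_axis)
  \<comment> \<open>This point has coordinate \<open>i\<close> equal to 0: moving inwards from the
    side excludes the inward unit vector.\<close>
  moreover have "z + axis i (- (z $ i)) \<in> Omega"
    using z(1) by (auto simp: Omega_iff axis_def)
  then have "- (z $ i) * n $ i \<le> 0"
    using le[of "z + axis i (- (z $ i))"] by (simp add: inner_axis')
  ultimately have "n $ i = z $ i"
    using z(2) by (auto simp: abs_if split: if_splits)
  then show "n \<in> {axis i (z $ i)}" using n_eq by simp
next
  fix n assume "n \<in> {axis i (z $ i)}"
  then show "n \<in> exterior_normals Omega z" using axis_in_exterior_normals_Omega[OF z(2)] by simp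
qed

text \<open>A corner has two distinct axis vectors among its normals, so requiring a single normal
  leaves exactly the open sides.\<close>

lemma smooth_boundary_Omega_iff:
  "z \<in> smooth_boundary Omega \<longleftrightarrow> (\<exists>i. \<bar>z $ i\<bar> = 1 \<and> (\<forall>j. j \<noteq> i \<longrightarrow> \<bar>z $ j\<bar> < 1))"
proof
  assume L: "z \<in> smooth_boundary Omega"
  then have z: "z \<in> Omega" "z \<notin> interior Omega" and "\<exists>n. exterior_normals Omega z = {n}"
    by (auto simp: smooth_boundary_def frontier_Omega)
  then obtain n where n: "exterior_normals Omega z = {n}" by blast
  obtain i where i: "\<bar>z $ i\<bar> = 1"
    using z unfolding Omega_iff interior_Omega_iff by (meson antisym_conv1)
  have "\<bar>z $ j\<bar> < 1" if "j \<noteq> i" for j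
  proof (rule ccontr)
    assume "\<not> \<bar>z $ j\<bar> < 1"
    then have "\<bar>z $ j\<bar> = 1" using z(1) by (simp add: Omega_iff antisym)
    from axis_in_exterior_normals_Omega[OF this] axis_in_exterior_normals_Omega[OF i] n
    have "axis j (z $ j) = axis i (z $ i)" by simp
    with that i show False by (auto simp: axis_eq_axis)
  qed
  with i show "\<exists>i. \<bar>z $ i\<bar> = 1 \<and> (\<forall>j. j \<noteq> i \<longrightarrow> \<bar>z $ j\<bar> < 1)" by blast
next
  assume "\<exists>i. \<bar>z $ i\<bar> = 1 \<and> (\<forall>j. j \<noteq> i \<longrightarrow> \<bar>z $ j\<bar> < 1)"
  then obtain i where i: "\<bar>z $ i\<bar> = 1" "\<And>j. j \<noteq> i \<Longrightarrow> \<bar>z $ j\<bar> < 1" by blast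
  then have "z \<in> Omega" unfolding Omega_iff by (metis order_le_less)
  moreover have "z \<notin> interior Omega" using i(1) by (auto simp: interior_Omega_iff intro!: exI[of _ i])
  ultimately show "z \<in> smooth_boundary Omega"
    using exterior_normal_Omega_unique[of z i] i
    by (auto simp: smooth_boundary_def frontier_Omega)
qed

lemma normal_Omega:
  assumes "\<bar>z $ i\<bar> = 1" "\<And>j. j \<noteq> i \<Longrightarrow> \<bar>z $ j\<bar> < 1"
  shows "normal Omega z = axis i (z $ i)"
proof -
  have "z \<in> Omega" unfolding Omega_iff using assms by (metis order_le_less)
  then show ?thesis
    using exterior_normal_Omega_unique[of z i] assms by (simp add: normal_def)
qed

text \<open>Composition with the segment gives a constant function of one variable, whose derivative
  is unique. The conclusion thus holds for any admissible \<open>D\<close>, even when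
  \<open>S\<close> is too thin for derivatives within it to be unique, as for the boundary
  curve.\<close>

lemma has_derivative_zero_along_segment:
  fixes f :: "'a::real_normed_vector \<Rightarrow> 'b::real_normed_vector"
  assumes D: "(f has_derivative D) (at z within S)" and "\<delta> > 0"
    and c: "\<And>t. \<bar>t\<bar> < \<delta> \<Longrightarrow> z + t *\<^sub>R v \<in> S \<and> f (z + t *\<^sub>R v) = c"
  shows "D v = 0"
proof -
  let ?T = "{-\<delta><..<\<delta>}" and ?g = "\<lambda>t. z + t *\<^sub>R v"
  have "(?g has_derivative (\<lambda>t. t *\<^sub>R v)) (at 0 within ?T)"
    by (auto intro!: derivative_eq_intros)
  moreover have "(f has_derivative D) (at (?g 0) within ?g ` ?T)"
  proof -
    have "?g ` ?T \<subseteq> S" using c by (auto simp: abs_less_iff)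
    then show ?thesis using has_derivative_subset[OF D] by simp
  qed
  ultimately have "((\<lambda>t. f (?g t)) has_derivative (\<lambda>t. D (t *\<^sub>R v))) (at 0 within ?T)"
    by (rule has_derivative_in_compose)
  then have "((\<lambda>t. c) has_derivative (\<lambda>t. D (t *\<^sub>R v))) (at 0 within ?T)"
    by (rule has_derivative_transform[rotated 2]) (use c \<open>\<delta> > 0\<close> in \<open>auto simp: abs_less_iff\<close>)
  then have "((\<lambda>t. c) has_derivative (\<lambda>t. D (t *\<^sub>R v))) (at 0)"
    using \<open>\<delta> > 0\<close> by (simp add: at_within_open[of _ ?T])
  then have "(\<lambda>t. D (t *\<^sub>R v)) = (\<lambda>t. 0)"
    by (rule has_derivative_unique) (rule has_derivative_const)
  from fun_cong[OF this, of 1] show ?thesis by simp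
qed

lemma axis_eq_scaleR: "axis i (s::real) = s *\<^sub>R axis i 1"
  by (simp add: vec_eq_iff axis_def)

lemma dir_deriv_scaleR:
  assumes "f differentiable_on S" "z \<in> S"
  shows "dir_deriv S f (c *\<^sub>R v) z = c *\<^sub>R dir_deriv S f v z"
  using has_derivative_linear[OF dir_deriv_works[OF assms]] by (rule linear_cmul)

text \<open>The vanishing of the tangential component says something about the chosen derivative
  only if the field is differentiable within the frontier. Near \<open>z\<close> the field is
  \<open>g\<close> times a constant vector, and \<open>g\<close> contains second derivatives of
  \<open>u\<close>, so C^3 regularity supplies this.\<close>

lemma tangential_hessian_term_eq_0:
  assumes C3: "C_k 3 Omega u"
    and Neumann: "\<And>z. z \<in> smooth_boundary Omega \<Longrightarrow> dir_deriv Omega u (normal Omega z) z = 0"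
    and z: "z \<in> smooth_boundary Omega"
  shows "tangent Omega z \<bullet> dir_deriv (frontier Omega)
      (\<lambda>x. hessian Omega u x *v normal Omega x) (tangent Omega z) z = 0"
proof -
  obtain i where i: "\<bar>z $ i\<bar> = 1" "\<And>j. j \<noteq> i \<Longrightarrow> \<bar>z $ j\<bar> < 1"
    using z by (auto simp: smooth_boundary_Omega_iff)
  obtain j :: 2 where j: "j \<noteq> i" "\<And>k. k = i \<or> k = j"
    using exhaust_2 by (metis (full_types) one_neq_zero zero_neq_one)
  define s where "s = z $ i"
  define E where "E = {x::real^2. x $ i = s \<and> \<bar>x $ j\<bar> < 1}"
  have s: "\<bar>s\<bar> = 1" using i by (simp add: s_def)
  have zE: "z \<in> E" using i j by (auto simp: E_def s_def)
  have E: "x \<in> Omega" "x \<in> smooth_boundary Omega" "x \<in> frontier Omega" "normal Omega x = axis i s"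
    if "x \<in> E" for x
  proof -
    have x: "\<bar>x $ i\<bar> = 1" "\<And>k. k \<noteq> i \<Longrightarrow> \<bar>x $ k\<bar> < 1" "x $ i = s"
      using that s j(2) by (auto simp: E_def)
    then show "x \<in> smooth_boundary Omega" by (auto simp: smooth_boundary_Omega_iff)
    then show "x \<in> frontier Omega" "x \<in> Omega"
      by (auto simp: smooth_boundary_def frontier_Omega)
    show "normal Omega x = axis i s" using normal_Omega[of x i] x by simp
  qed
  have segment: "x + t *\<^sub>R axis j 1 \<in> E" if "x \<in> E" "\<bar>t\<bar> < 1 - \<bar>x $ j\<bar>" for x t
    using that j(1) by (auto simp: E_def axis_def)
  let ?w = "dir_deriv Omega u (axis i 1)"
  have diff: "u differentiable_on Omega" "?w differentiable_on Omega"
    "dir_deriv Omega ?w (axis i 1) differentiable_on Omega"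
    using C3 by (simp_all add: eval_nat_numeral)
  have w0: "?w x = 0" if "x \<in> E" for x
    using Neumann[OF E(2)[OF that]] E(4)[OF that] dir_deriv_scaleR[OF diff(1) E(1)[OF that]] s
    by (auto simp: axis_eq_scaleR[of i s])
  have wj0: "dir_deriv Omega ?w (axis j 1) x = 0" if "x \<in> E" for x
  proof (rule has_derivative_zero_along_segment
      [where D = "\<lambda>v. dir_deriv Omega ?w v x" and v = "axis j 1"])
    show "(?w has_derivative (\<lambda>v. dir_deriv Omega ?w v x)) (at x within Omega)"
      by (rule dir_deriv_works[OF diff(2) E(1)[OF that]])
    show "1 - \<bar>x $ j\<bar> > 0" using that by (simp add: E_def)
    show "x + t *\<^sub>R axis j 1 \<in> Omega \<and> ?w (x + t *\<^sub>R axis j 1) = 0" if "\<bar>t\<bar> < 1 - \<bar>x $ j\<bar>" for t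
      using segment[OF \<open>x \<in> E\<close> that] E(1) w0 by blast
  qed
  define h where "h = (\<lambda>x. hessian Omega u x *v normal Omega x)"
  define g where "g = (\<lambda>x. s * dir_deriv Omega ?w (axis i 1) x)"
  \<comment> \<open>In \<open>hessian\<close> the column index belongs to the inner derivative, so
    component \<open>k\<close> differentiates \<open>?w\<close> once more, in direction
    \<open>k\<close>.\<close>
  have h_nth: "h x $ k = s * dir_deriv Omega ?w (axis k 1) x" if "x \<in> E" for x k
    using E(4)[OF that]
    by (simp add: h_def matrix_vector_mult_def hessian_def axis_def if_distrib cong: if_cong)
  have h_eq: "h x = g x *\<^sub>R axis i 1" if "x \<in> E" for x
    using j(2) wj0[OF that] h_nth[OF that] by (auto simp: vec_eq_iff g_def axis_def)
  \<comment> \<open>Within this radius coordinate \<open>i\<close> keeps the sign of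
    \<open>s\<close> and coordinate \<open>j\<close> stays strictly inside, so a frontier point can
    only lie on the same side.\<close>
  have near: "x \<in> E" if "x \<in> frontier Omega" "dist x z < 1 - \<bar>z $ j\<bar>" for x
  proof -
    have "\<bar>x $ k - z $ k\<bar> < 1 - \<bar>z $ j\<bar>" for k
      using that(2) component_le_norm_cart[of "x - z" k] by (simp add: dist_norm)
    from this[of i] this[of j] have d: "\<bar>x $ i - s\<bar> < 1" "\<bar>x $ j\<bar> < 1" by (auto simp: s_def)
    from that(1) obtain k where "\<bar>x $ k\<bar> \<ge> 1" and le: "\<And>k. \<bar>x $ k\<bar> \<le> 1"
      by (auto simp: frontier_Omega Omega_iff interior_Omega_iff not_less)
    then have "\<bar>x $ i\<bar> = 1" using j(2)[of k] d(2) le[of i] by (auto intro: antisym)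
    then show ?thesis using d s by (auto simp: E_def)
  qed
  have "(g has_derivative (\<lambda>v. s * dir_deriv Omega (dir_deriv Omega ?w (axis i 1)) v z))
      (at z within frontier Omega)"
    unfolding g_def
    by (rule has_derivative_subset[OF has_derivative_mult_right[OF dir_deriv_works[OF diff(3) E(1)[OF zE]]]])
       (auto simp: frontier_Omega)
  then have "((\<lambda>x. g x *\<^sub>R axis i 1) has_derivative
      (\<lambda>v. (s * dir_deriv Omega (dir_deriv Omega ?w (axis i 1)) v z) *\<^sub>R (axis i 1 :: real^2)))
      (at z within frontier Omega)"
    by (rule has_derivative_scaleR_left)
  then have "(h has_derivative
      (\<lambda>v. (s * dir_deriv Omega (dir_deriv Omega ?w (axis i 1)) v z) *\<^sub>R (axis i 1 :: real^2)))
      (at z within frontier Omega)"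
    by (rule has_derivative_transform_within[where d = "1 - \<bar>z $ j\<bar>"])
       (use E(3)[OF zE] near zE h_eq in \<open>auto simp: E_def\<close>)
  \<comment> \<open>What counts here is the existence of a derivative: the chosen one may differ
    from the explicit one off the tangent.\<close>
  then have D': "(h has_derivative (\<lambda>v. dir_deriv (frontier Omega) h v z)) (at z within frontier Omega)"
    unfolding dir_deriv_def by (metis differentiableI frechet_derivative_works)
  have "dir_deriv (frontier Omega) h (axis j 1) z $ j = 0"
  proof (rule has_derivative_zero_along_segment
      [where D = "\<lambda>v. dir_deriv (frontier Omega) h v z $ j" and v = "axis j 1"])
    show "((\<lambda>x. h x $ j) has_derivative (\<lambda>v. dir_deriv (frontier Omega) h v z $ j))
        (at z within frontier Omega)"
      by (rule bounded_linear.has_derivative[OF bounded_linear_vec_nth D'])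
    show "1 - \<bar>z $ j\<bar> > 0" using zE by (simp add: E_def)
    show "z + t *\<^sub>R axis j 1 \<in> frontier Omega \<and> h (z + t *\<^sub>R axis j 1) $ j = 0"
      if "\<bar>t\<bar> < 1 - \<bar>z $ j\<bar>" for t
      using segment[OF zE that] E(3) h_nth wj0 by auto
  qed
  moreover have "\<exists>r. tangent Omega z = r *\<^sub>R axis j 1"
    using exhaust_2[of i] exhaust_2[of j] j(1) E(4)[OF zE]
    by (auto simp: tangent_def vec_eq_iff axis_def forall_2)
  then obtain r where "tangent Omega z = r *\<^sub>R axis j 1" by blast
  moreover have "dir_deriv (frontier Omega) h (r *\<^sub>R axis j 1) z
      = r *\<^sub>R dir_deriv (frontier Omega) h (axis j 1) z"
    using has_derivative_linear[OF D'] by (rule linear_cmul)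
  ultimately show ?thesis
    by (simp add: h_def inner_axis')
qed

lemma solves_A_iff_solves_B: "solves_A Omega \<mu> u \<longleftrightarrow> solves_B Omega \<mu> u"
  unfolding solves_A_def solves_B_def
  using tangential_hessian_term_eq_0[of u] by (smt (verit, ccfv_threshold))

subsection \<open>Linearity of problem (B)\<close>

text \<open>The expansion describes an eigenfunction on the closed square alone; this moves
  \<open>solves_B\<close> from the finite sum to \<open>u\<close>, whose values elsewhere are
  arbitrary.\<close>

lemma solves_B_cong:
  assumes "\<And>x. x \<in> S \<Longrightarrow> f x = g x" "solves_B S \<mu> f" "closed S"
  shows "solves_B S \<mu> g"
proof -
  have int: "\<And>x. x \<in> interior S \<Longrightarrow> f x = g x" using assms(1) interior_subset by blast
  have bd: "z \<in> S" if "z \<in> smooth_boundary S" for z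
    using that assms(3) frontier_subset_closed by (auto simp: smooth_boundary_def)
  have "C_k 4 (interior S) g" "C_k 3 S g"
    using assms(2) C_k_cong[OF int] C_k_cong[OF assms(1)] by (auto simp: solves_B_def)
  moreover have "bilaplacian S g z = \<mu> * g z" if "z \<in> interior S" for z
    using assms(2) int[OF that] that subsetD[OF interior_subset that]
      bilaplacian_cong[of z S f g, OF _ assms(1)]
    by (simp add: solves_B_def)
  moreover have "dir_deriv S g v z = 0" if "dir_deriv S f v z = 0" "z \<in> smooth_boundary S" for v z
    using that dir_deriv_cong[of z S f g, OF bd assms(1)] by simp
  moreover have "dir_deriv S (laplacian S g) v z = 0"
    if "dir_deriv S (laplacian S f) v z = 0" "z \<in> smooth_boundary S" for v z
    using that dir_deriv_cong[of z S "laplacian S f" "laplacian S g", OF bd laplacian_cong[OF _ assms(1)]]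
    by simp
  ultimately show ?thesis
    using assms(2) unfolding solves_B_def by blast
qed

lemma bilaplacian_interior_add:
  assumes "z \<in> interior S" "C_k 4 (interior S) f" "C_k 4 (interior S) g"
  shows "bilaplacian S (\<lambda>x. f x + g x) z = bilaplacian S f z + bilaplacian S g z"
  using bilaplacian_add[OF unique_derivatives_open[OF open_interior] assms] assms(1)
  by (simp add: bilaplacian_interior)

lemma bilaplacian_interior_cmult:
  assumes "z \<in> interior S" "C_k 4 (interior S) f"
  shows "bilaplacian S (\<lambda>x. c * f x) z = c * bilaplacian S f z"
  using bilaplacian_cmult[OF unique_derivatives_open[OF open_interior] assms] assms(1)
  by (simp add: bilaplacian_interior)

lemma solves_B_add:
  assumes S: "unique_derivatives S" "closed S" and fg: "solves_B S \<mu> f" "solves_B S \<mu> g"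
  shows "solves_B S \<mu> (\<lambda>x. f x + g x)"
proof -
  have C: "C_k 4 (interior S) f" "C_k 4 (interior S) g" "C_k 3 S f" "C_k 3 S g"
    using fg by (auto simp: solves_B_def)
  have C2: "C_k 2 S f" "C_k 2 S g" using C(3,4) by (auto intro: C_k_antimono[of 2 3])
  have L: "laplacian S f differentiable_on S" "laplacian S g differentiable_on S"
    using C_k_laplacian[OF S(1), of 1 f] C_k_laplacian[OF S(1), of 1 g] C(3,4)
    by (simp_all add: eval_nat_numeral)
  have bd: "z \<in> S" if "z \<in> smooth_boundary S" for z
    using that S(2) frontier_subset_closed by (auto simp: smooth_boundary_def)
  have "dir_deriv S (laplacian S (\<lambda>x. f x + g x)) v z =
      dir_deriv S (laplacian S f) v z + dir_deriv S (laplacian S g) v z" if "z \<in> S" for v z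
  proof -
    have "dir_deriv S (laplacian S (\<lambda>x. f x + g x)) v z =
        dir_deriv S (\<lambda>z. laplacian S f z + laplacian S g z) v z"
      by (rule dir_deriv_cong[OF that]) (rule laplacian_add[OF S(1) _ C2])
    also have "\<dots> = dir_deriv S (laplacian S f) v z + dir_deriv S (laplacian S g) v z"
      by (rule dir_deriv_add[OF S(1) that L])
    finally show ?thesis .
  qed
  moreover have "dir_deriv S (\<lambda>x. f x + g x) v z = dir_deriv S f v z + dir_deriv S g v z"
    if "z \<in> S" for v z
    by (rule dir_deriv_add[OF S(1) that C_k_2_D(1)[OF C2(1)] C_k_2_D(1)[OF C2(2)]])
  ultimately show ?thesis
    using fg C_k_add[OF S(1) C(3,4)] C_k_add[OF unique_derivatives_open[OF open_interior] C(1,2)]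
      bilaplacian_interior_add[OF _ C(1,2)] bd
    unfolding solves_B_def by (simp add: distrib_left)
qed

lemma solves_B_cmult:
  assumes S: "unique_derivatives S" "closed S" and f: "solves_B S \<mu> f"
  shows "solves_B S \<mu> (\<lambda>x. c * f x)"
proof -
  have C: "C_k 4 (interior S) f" "C_k 3 S f"
    using f by (auto simp: solves_B_def)
  have C2: "C_k 2 S f" using C(2) by (auto intro: C_k_antimono[of 2 3])
  have L: "laplacian S f differentiable_on S"
    using C_k_laplacian[OF S(1), of 1 f] C(2) by (simp_all add: eval_nat_numeral)
  have bd: "z \<in> S" if "z \<in> smooth_boundary S" for z
    using that S(2) frontier_subset_closed by (auto simp: smooth_boundary_def)
  have "dir_deriv S (laplacian S (\<lambda>x. c * f x)) v z = c * dir_deriv S (laplacian S f) v z"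
    if "z \<in> S" for v z
  proof -
    have "dir_deriv S (laplacian S (\<lambda>x. c * f x)) v z = dir_deriv S (\<lambda>z. c * laplacian S f z) v z"
      by (rule dir_deriv_cong[OF that]) (rule laplacian_cmult[OF S(1) _ C2])
    also have "\<dots> = c * dir_deriv S (laplacian S f) v z"
      by (rule dir_deriv_cmult[OF S(1) that L])
    finally show ?thesis .
  qed
  moreover have "dir_deriv S (\<lambda>x. c * f x) v z = c * dir_deriv S f v z" if "z \<in> S" for v z
    by (rule dir_deriv_cmult[OF S(1) that C_k_2_D(1)[OF C2]])
  ultimately show ?thesis
    using f C_k_cmult[OF S(1) C(2)] C_k_cmult[OF unique_derivatives_open[OF open_interior] C(1)]
      bilaplacian_interior_cmult[OF _ C(1)] bd
    unfolding solves_B_def by simp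
qed

subsection \<open>Integration over the square\<close>

lemma vector_2_in_cbox:
  "(vector [x, y] :: real^2) \<in> cbox a b \<longleftrightarrow> (x, y) \<in> cbox (a $ 1, a $ 2) (b $ 1, b $ 2)"
  by (auto simp: mem_box_cart forall_2 cbox_Pair_eq)

lemma continuous_on_vector_2 [continuous_intros]:
  assumes "continuous_on S f" "continuous_on S g"
  shows "continuous_on S (\<lambda>x. vector [f x, g x] :: real^2)"
proof -
  have "(\<lambda>x. vector [f x, g x] :: real^2) = (\<lambda>x. \<chi> i. if i = 1 then f x else g x)"
    by (auto simp: fun_eq_iff vec_eq_iff forall_2)
  moreover have "continuous_on S (\<lambda>x. \<chi> i::2. if i = 1 then f x else g x)"
  proof (rule continuous_on_vec_lambda)
    show "continuous_on S (\<lambda>x. if i = 1 then f x else g x)" for i :: 2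
      using assms by (cases "i = 1") simp_all
  qed
  ultimately show ?thesis by metis
qed

text \<open>Fubini is transported from pairs through the coordinate map, which preserves the volume
  of boxes (factor 1). Both orders are recorded, since each partial derivative is to be integrated
  in its own variable first.\<close>

lemma integral_cbox_vec_2:
  fixes f :: "real^2 \<Rightarrow> real"
  assumes f: "continuous_on (cbox a b) f"
  shows "integral (cbox a b) f
    = integral {a $ 1..b $ 1} (\<lambda>x. integral {a $ 2..b $ 2} (\<lambda>y. f (vector [x, y])))"
    and "integral (cbox a b) f
    = integral {a $ 2..b $ 2} (\<lambda>y. integral {a $ 1..b $ 1} (\<lambda>x. f (vector [x, y])))"
proof -
  let ?g = "\<lambda>p::real \<times> real. vector [fst p, snd p] :: real^2"
  let ?h = "\<lambda>z::real^2. (z $ 1, z $ 2)"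
  have gh: "?g (?h z) = z" for z by (simp add: vec_eq_iff forall_2)
  have hg: "?h (?g p) = p" for p by simp
  have h_img: "?h ` cbox u v = cbox (?h u) (?h v)" for u v
  proof (intro equalityI subsetI)
    fix p assume "p \<in> cbox (?h u) (?h v)"
    then have "?g p \<in> cbox u v" by (simp add: vector_2_in_cbox)
    then show "p \<in> ?h ` cbox u v" by (rule image_eqI[rotated]) simp
  qed (auto simp: mem_box_cart cbox_Pair_eq)
  have g_img: "?g ` cbox u v = cbox (?g u) (?g v)" for u v
  proof -
    have "cbox u v = ?h ` cbox (?g u) (?g v)" by (simp add: h_img)
    then show ?thesis using gh by (simp add: image_image)
  qed
  have content: "measure lborel (?g ` cbox u v) = 1 * measure lborel (cbox u v)" for u v
  proof -
    have "measure lborel (cbox u v) = measure lborel (cbox (fst u) (fst v)) * measure lborel (cbox (snd u) (snd v))"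
      by (metis content_Pair prod.collapse)
    moreover have "cbox (?g u) (?g v) \<noteq> {} \<longleftrightarrow> fst u \<le> fst v \<and> snd u \<le> snd v"
      by (auto simp: interval_ne_empty_cart forall_2)
    ultimately show ?thesis
      by (auto simp: g_img content_cbox_if_cart UNIV_2)
  qed
  have cont: "continuous (at p) ?g" for p
  proof -
    have "continuous_on UNIV ?g" by (intro continuous_intros)
    then show ?thesis by (metis continuous_on_eq_continuous_at open_UNIV UNIV_I)
  qed
  have "(f has_integral integral (cbox a b) f) (cbox a b)"
    using f by (simp add: integrable_continuous integrable_integral)
  from has_integral_twiddle[of 1 ?h ?g, OF _ hg gh cont _ _ content this]
  have "((\<lambda>p. f (?g p)) has_integral integral (cbox a b) f) (cbox (?h a) (?h b))"
    using g_img h_img by (auto simp: h_img)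
  then have eq: "integral (cbox a b) f = integral (cbox (?h a) (?h b)) (\<lambda>p. f (?g p))"
    by (simp add: integral_unique)
  have contf: "continuous_on (cbox (?h a) (?h b)) (\<lambda>p. f (?g p))"
    by (rule continuous_on_compose2[OF f]) (auto intro!: continuous_intros simp: vector_2_in_cbox)
  show "integral (cbox a b) f
    = integral {a $ 1..b $ 1} (\<lambda>x. integral {a $ 2..b $ 2} (\<lambda>y. f (vector [x, y])))"
    using integral_prod_continuous[OF contf] by (simp add: eq)
  also have "\<dots> = integral {a $ 2..b $ 2} (\<lambda>y. integral {a $ 1..b $ 1} (\<lambda>x. f (vector [x, y])))"
    using integral_swap_continuous[of "a $ 1" "a $ 2" "b $ 1" "b $ 2" "\<lambda>x y. f (vector [x, y])"]
      contf by (simp add: case_prod_unfold)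
  finally show "integral (cbox a b) f
    = integral {a $ 2..b $ 2} (\<lambda>y. integral {a $ 1..b $ 1} (\<lambda>x. f (vector [x, y])))" .
qed

lemma integral_Omega:
  fixes f :: "real^2 \<Rightarrow> real"
  assumes "continuous_on Omega f"
  shows "integral Omega f = integral {-1..1} (\<lambda>x. integral {-1..1} (\<lambda>y. f (vector [x, y])))"
    and "integral Omega f = integral {-1..1} (\<lambda>y. integral {-1..1} (\<lambda>x. f (vector [x, y])))"
  using integral_cbox_vec_2[of "vector [-1, -1]" "vector [1, 1]" f] assms
  by (simp_all add: Omega_def)

lemma integrable_on_Omega: "continuous_on Omega f \<Longrightarrow> f integrable_on Omega"
  for f :: "real^2 \<Rightarrow> real"
  by (simp add: Omega_def integrable_continuous)

lemma compact_Omega: "compact Omega"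
  by (simp add: Omega_def compact_cbox)

section \<open>The divergence theorem on the square\<close>

lemma scaleR_in_Omega: "z \<in> Omega \<Longrightarrow> 0 \<le> r \<Longrightarrow> r \<le> 1 \<Longrightarrow> r *\<^sub>R z \<in> Omega"
  unfolding Omega_iff by (auto simp: abs_mult intro!: mult_le_one)

lemma scaleR_in_interior_Omega:
  assumes "z \<in> Omega" "0 \<le> r" "r < 1" shows "r *\<^sub>R z \<in> interior Omega"
  unfolding interior_Omega_iff
proof
  fix i
  have "r * \<bar>z $ i\<bar> \<le> r * 1" using assms by (intro mult_left_mono) (auto simp: Omega_iff)
  then show "\<bar>(r *\<^sub>R z) $ i\<bar> < 1" using assms by (simp add: abs_mult)
qed

text \<open>For r < 1 the points r z stay in a compact part of the interior, where the fields are
  C^1, so the fundamental theorem of calculus applies along horizontal and vertical lines. The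
  factor \<open>r\<close> in the integrand is the chain rule factor of the scaling.\<close>

lemma divergence_scaled:
  assumes P: "C_k 1 (interior Omega) P" and Q: "C_k 1 (interior Omega) Q" and r: "0 \<le> r" "r < 1"
  defines "p \<equiv> dir_deriv (interior Omega) P (axis 1 1)"
    and "q \<equiv> dir_deriv (interior Omega) Q (axis 2 1)"
  shows "integral Omega (\<lambda>z. r * (p (r *\<^sub>R z) + q (r *\<^sub>R z))) =
    integral {-1..1} (\<lambda>t. P (r *\<^sub>R vector [1, t]) - P (r *\<^sub>R vector [-1, t])
                        + (Q (r *\<^sub>R vector [t, 1]) - Q (r *\<^sub>R vector [t, -1])))"
proof -
  have diff: "P differentiable_on interior Omega" "Q differentiable_on interior Omega"
    and cont: "continuous_on (interior Omega) P" "continuous_on (interior Omega) Q"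
      "continuous_on (interior Omega) p" "continuous_on (interior Omega) q"
    using P Q by (auto simp: p_def q_def differentiable_imp_continuous_on)
  have scaled: "continuous_on Omega (\<lambda>z. f (r *\<^sub>R z))"
    if "continuous_on (interior Omega) f" for f :: "real^2 \<Rightarrow> real"
    using that by (rule continuous_on_compose2)
      (auto intro!: continuous_intros scaleR_in_interior_Omega r)
  have edge: "continuous_on {-1..1} (\<lambda>t. f (r *\<^sub>R vector [g t, h t]))"
    if "continuous_on (interior Omega) f" "continuous_on {-1..1} g" "continuous_on {-1..1} h"
      "\<And>t. t \<in> {-1..1} \<Longrightarrow> \<bar>g t\<bar> \<le> 1 \<and> \<bar>h t\<bar> \<le> 1" for f :: "real^2 \<Rightarrow> real" and g h :: "real \<Rightarrow> real"
    using that(1) by (rule continuous_on_compose2)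
      (use that in \<open>auto intro!: continuous_intros scaleR_in_interior_Omega r simp: Omega_iff forall_2\<close>)
  have int: "r *\<^sub>R vector [x, y] \<in> interior Omega" if "x \<in> {-1..1}" "y \<in> {-1..1}" for x y
    using that by (intro scaleR_in_interior_Omega r) (auto simp: Omega_iff forall_2)
  have der: "(f has_derivative (\<lambda>v. dir_deriv (interior Omega) f v z)) (at z)"
    if "f differentiable_on interior Omega" "z \<in> interior Omega" for f :: "real^2 \<Rightarrow> real" and z
    using dir_deriv_works[OF that] that(2) by (simp add: at_within_open[OF _ open_interior])
  have lin: "dir_deriv (interior Omega) f (c *\<^sub>R v) z = c * dir_deriv (interior Omega) f v z"
    if "f differentiable_on interior Omega" "z \<in> interior Omega" for f :: "real^2 \<Rightarrow> real" and z v c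
    using dir_deriv_scaleR[OF that] by simp
  \<comment> \<open>\<open>\<gamma>\<close> has constant velocity r v; taking v as either axis
    vector covers both families of lines.\<close>
  have ftc: "integral {-1..1} (\<lambda>t. r * dir_deriv (interior Omega) f v (\<gamma> t)) = f (\<gamma> 1) - f (\<gamma> (-1))"
    if f: "f differentiable_on interior Omega" and g: "\<And>t. t \<in> {-1..1} \<Longrightarrow> \<gamma> t \<in> interior Omega"
      "\<And>t. (\<gamma> has_derivative (\<lambda>s. s *\<^sub>R (r *\<^sub>R v))) (at t within {-1..1})"
    for f :: "real^2 \<Rightarrow> real" and v and \<gamma> :: "real \<Rightarrow> real^2"
  proof (rule integral_unique, rule fundamental_theorem_of_calculus)
    fix t :: real assume t: "t \<in> {-1..1}"
    have "((\<lambda>t. f (\<gamma> t)) has_derivative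
        (\<lambda>s. dir_deriv (interior Omega) f (s *\<^sub>R (r *\<^sub>R v)) (\<gamma> t))) (at t within {-1..1})"
      by (rule has_derivative_compose[OF g(2) der[OF f g(1)[OF t]]])
    then show "((\<lambda>t. f (\<gamma> t)) has_vector_derivative r * dir_deriv (interior Omega) f v (\<gamma> t))
        (at t within {-1..1})"
      by (simp add: has_vector_derivative_def lin[OF f g(1)[OF t]] mult.assoc)
  qed simp
  have vec: "(\<lambda>t. r *\<^sub>R (vector [t, y] :: real^2)) = (\<lambda>t. t *\<^sub>R (r *\<^sub>R axis 1 1) + (r * y) *\<^sub>R axis 2 1)"
    "(\<lambda>t. r *\<^sub>R (vector [x, t] :: real^2)) = (\<lambda>t. (r * x) *\<^sub>R axis 1 1 + t *\<^sub>R (r *\<^sub>R axis 2 1))" for x y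
    by (auto simp: fun_eq_iff vec_eq_iff forall_2 axis_def)
  have Ip: "integral Omega (\<lambda>z. r * p (r *\<^sub>R z))
      = integral {-1..1} (\<lambda>t. P (r *\<^sub>R vector [1, t]) - P (r *\<^sub>R vector [-1, t]))"
  proof -
    have "integral Omega (\<lambda>z. r * p (r *\<^sub>R z)) =
        integral {-1..1} (\<lambda>y. integral {-1..1} (\<lambda>x. r * p (r *\<^sub>R vector [x, y])))"
      by (intro integral_Omega continuous_intros scaled cont)
    also have "\<dots> = integral {-1..1} (\<lambda>t. P (r *\<^sub>R vector [1, t]) - P (r *\<^sub>R vector [-1, t]))"
    proof (rule integral_cong)
      fix y :: real assume "y \<in> {-1..1}"
      then show "integral {-1..1} (\<lambda>x. r * p (r *\<^sub>R vector [x, y]))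
          = P (r *\<^sub>R vector [1, y]) - P (r *\<^sub>R vector [-1, y])"
        unfolding p_def
        by (intro ftc[where \<gamma> = "\<lambda>t. r *\<^sub>R vector [t, y]"] diff int)
           (auto simp: vec intro!: derivative_eq_intros)
    qed
    finally show ?thesis .
  qed
  have Iq: "integral Omega (\<lambda>z. r * q (r *\<^sub>R z))
      = integral {-1..1} (\<lambda>t. Q (r *\<^sub>R vector [t, 1]) - Q (r *\<^sub>R vector [t, -1]))"
  proof -
    have "integral Omega (\<lambda>z. r * q (r *\<^sub>R z)) =
        integral {-1..1} (\<lambda>x. integral {-1..1} (\<lambda>y. r * q (r *\<^sub>R vector [x, y])))"
      by (intro integral_Omega continuous_intros scaled cont)
    also have "\<dots> = integral {-1..1} (\<lambda>t. Q (r *\<^sub>R vector [t, 1]) - Q (r *\<^sub>R vector [t, -1]))"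
    proof (rule integral_cong)
      fix x :: real assume "x \<in> {-1..1}"
      then show "integral {-1..1} (\<lambda>y. r * q (r *\<^sub>R vector [x, y]))
          = Q (r *\<^sub>R vector [x, 1]) - Q (r *\<^sub>R vector [x, -1])"
        unfolding q_def
        by (intro ftc[where \<gamma> = "\<lambda>t. r *\<^sub>R vector [x, t]"] diff int)
           (auto simp: vec intro!: derivative_eq_intros)
    qed
    finally show ?thesis .
  qed
  have "integral Omega (\<lambda>z. r * (p (r *\<^sub>R z) + q (r *\<^sub>R z)))
      = integral Omega (\<lambda>z. r * p (r *\<^sub>R z)) + integral Omega (\<lambda>z. r * q (r *\<^sub>R z))"
    unfolding distrib_left
    by (intro integral_add integrable_on_Omega continuous_intros scaled cont)
  also have "\<dots> = integral {-1..1} (\<lambda>t. P (r *\<^sub>R vector [1, t]) - P (r *\<^sub>R vector [-1, t])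
                        + (Q (r *\<^sub>R vector [t, 1]) - Q (r *\<^sub>R vector [t, -1])))"
    unfolding Ip Iq
    by (intro integral_add[symmetric] integrable_continuous_interval continuous_intros edge cont) auto
  finally show ?thesis .
qed

text \<open>
  Only the sum of the two partial derivatives extends continuously to the closed square; each of them
  may be unbounded near the boundary.  Therefore the divergence theorem is applied on the smaller
  squares \<open>r\<cdot>Omega\<close>, rescaled to \<open>Omega\<close>, where both sides are continuous in \<open>r \<in> {0..1}\<close>.
\<close>

lemma divergence_Omega:
  fixes P Q d :: "real^2 \<Rightarrow> real"
  assumes P: "continuous_on Omega P" "C_k 1 (interior Omega) P"
    and Q: "continuous_on Omega Q" "C_k 1 (interior Omega) Q"
    and d: "continuous_on Omega d"
      "\<And>z. z \<in> interior Omega \<Longrightarrow>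
        d z = dir_deriv (interior Omega) P (axis 1 1) z + dir_deriv (interior Omega) Q (axis 2 1) z"
    and P0: "\<And>z. \<bar>z $ 1\<bar> = 1 \<Longrightarrow> \<bar>z $ 2\<bar> < 1 \<Longrightarrow> P z = 0"
    and Q0: "\<And>z. \<bar>z $ 2\<bar> = 1 \<Longrightarrow> \<bar>z $ 1\<bar> < 1 \<Longrightarrow> Q z = 0"
  shows "integral Omega d = 0"
proof -
  define L where "L = (\<lambda>r. integral Omega (\<lambda>z. r * d (r *\<^sub>R z)))"
  define B where "B = (\<lambda>r t. P (r *\<^sub>R vector [1, t]) - P (r *\<^sub>R vector [-1, t])
                        + (Q (r *\<^sub>R vector [t, 1]) - Q (r *\<^sub>R vector [t, -1])))"
  have "continuous_on ({0..1} \<times> Omega) (\<lambda>(r, z). r * d (r *\<^sub>R z))"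
    unfolding case_prod_unfold
    by (intro continuous_intros continuous_on_compose2[OF d(1)]) (auto intro: scaleR_in_Omega)
  then have "continuous_on {0..1} L"
    unfolding L_def Omega_def by (rule integral_continuous_on_param)
  moreover have "continuous_on {0..1} (\<lambda>r. integral {-1..1} (B r))"
  proof -
    have "continuous_on ({0..1} \<times> {-1..1}) (\<lambda>(r, t). B r t)"
      unfolding case_prod_unfold B_def
      by (intro continuous_intros continuous_on_compose2[OF P(1)] continuous_on_compose2[OF Q(1)])
         (auto intro!: scaleR_in_Omega simp: Omega_iff forall_2)
    then show ?thesis
      using integral_continuous_on_param[of "{0..1}" "-1" 1 B] by simp
  qed
  ultimately have "continuous_on (closure {0..<1}) (\<lambda>r. L r - integral {-1..1} (B r))"
    by (simp add: continuous_on_diff)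
  moreover have "L r - integral {-1..1} (B r) = 0" if "r \<in> {0..<1}" for r
  proof -
    have "L r = integral Omega (\<lambda>z. r * (dir_deriv (interior Omega) P (axis 1 1) (r *\<^sub>R z)
        + dir_deriv (interior Omega) Q (axis 2 1) (r *\<^sub>R z)))"
      unfolding L_def using that
      by (intro integral_cong arg_cong2[where f = "(*)"] refl d(2) scaleR_in_interior_Omega) auto
    then show ?thesis
      using divergence_scaled[OF P(2) Q(2), of r] that by (simp add: B_def)
  qed
  ultimately have "L 1 - integral {-1..1} (B 1) = 0"
    by (rule continuous_constant_on_closure[where x = "1::real" and f = "\<lambda>r. L r - integral {-1..1} (B r)"])
       simp_all
  \<comment> \<open>At r = 1 all four boundary terms vanish for \<bar>t\<bar> < 1; t = 1 and t = -1
    are the corners, where the values of \<open>P\<close> and \<open>Q\<close> are not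
    prescribed.\<close>
  moreover have "(B 1 has_integral 0) {-1..1}"
    by (rule has_integral_spike_finite[of "{-1, 1}" _ _ "\<lambda>_. 0"]) (auto simp: B_def P0 Q0)
  ultimately show ?thesis by (simp add: L_def integral_unique)
qed

section \<open>Green's second identity under Neumann conditions\<close>

text \<open>The regularity is what \<open>u\<close> and its Laplacian have in common: C^3 up to the
  boundary and C^4 inside leave C^1 and C^2 for the Laplacian. One predicate thus serves both
  applications of Green's identity.\<close>

definition neumann :: "(real^2 \<Rightarrow> real) \<Rightarrow> bool" where
  "neumann f \<longleftrightarrow> C_k 1 Omega f \<and> C_k 2 (interior Omega) f \<and>
     (\<forall>z\<in>smooth_boundary Omega. dir_deriv Omega f (normal Omega z) z = 0)"

lemma neumann_D:
  assumes "neumann f" "\<bar>z $ i\<bar> = 1" "\<And>j. j \<noteq> i \<Longrightarrow> \<bar>z $ j\<bar> < 1"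
  shows "dir_deriv Omega f (axis i 1) z = 0"
proof -
  have z: "z \<in> smooth_boundary Omega" using assms by (auto simp: smooth_boundary_Omega_iff)
  then have "z \<in> Omega" by (auto simp: smooth_boundary_def frontier_Omega)
  moreover have "f differentiable_on Omega" using assms(1) by (simp add: neumann_def)
  ultimately have "dir_deriv Omega f (axis i (z $ i)) z = z $ i * dir_deriv Omega f (axis i 1) z"
    by (subst axis_eq_scaleR) (simp add: dir_deriv_scaleR)
  moreover have "dir_deriv Omega f (axis i (z $ i)) z = 0"
    using assms z normal_Omega[of z i] by (auto simp: neumann_def)
  ultimately show ?thesis using assms(2) by auto
qed

lemma dir_deriv_mult:
  fixes f g :: "'a::real_normed_vector \<Rightarrow> real"
  assumes "unique_derivatives S" "z \<in> S" "f differentiable_on S" "g differentiable_on S"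
  shows "dir_deriv S (\<lambda>x. f x * g x) v z = f z * dir_deriv S g v z + dir_deriv S f v z * g z"
  by (rule dir_deriv_eqI[OF assms(1,2) has_derivative_mult[OF dir_deriv_works dir_deriv_works]])
     (use assms in auto)

lemma C_1_mult:
  fixes f g :: "'a::real_normed_vector \<Rightarrow> real"
  assumes "unique_derivatives S" "C_k 1 S f" "C_k 1 S g"
  shows "C_k 1 S (\<lambda>x. f x * g x)"
proof -
  have d: "f differentiable_on S" "g differentiable_on S" using assms(2,3) by simp_all
  have "continuous_on S (\<lambda>z. f z * dir_deriv S g v z + dir_deriv S f v z * g z)" for v
    using assms(2,3)
    by (intro continuous_intros differentiable_imp_continuous_on[OF d(1)]
        differentiable_imp_continuous_on[OF d(2)]) simp_all
  then have "continuous_on S (dir_deriv S (\<lambda>x. f x * g x) v)" for v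
    by (rule continuous_on_eq) (simp add: dir_deriv_mult[OF assms(1) _ d])
  then show ?thesis using d by (simp add: differentiable_on_def)
qed

text \<open>\<open>P\<close> is the component in direction \<open>v\<close> of g grad f - f grad g;
  the product of first derivatives cancels when it is differentiated. Subtraction is written as
  adding a multiple by -1 so that \<open>C_k_add\<close> and \<open>C_k_cmult\<close> apply.\<close>

lemma green_component:
  fixes f g :: "real^2 \<Rightarrow> real" and v :: "real^2"
  assumes S: "unique_derivatives S" and f: "C_k 2 S f" and g: "C_k 2 S g"
  defines "P \<equiv> \<lambda>z. dir_deriv S f v z * g z + (-1) * (f z * dir_deriv S g v z)"
  shows "C_k 1 S P"
    and "z \<in> S \<Longrightarrow> dir_deriv S P v z = dir_deriv S (dir_deriv S f v) v z * g z
      - f z * dir_deriv S (dir_deriv S g v) v z"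
proof -
  note C1 = C_k_antimono[OF one_le_numeral f] C_k_antimono[OF one_le_numeral g]
  have D1: "C_k 1 S (dir_deriv S f v)" "C_k 1 S (dir_deriv S g v)"
    using f g by (auto simp: numeral_2_eq_2)
  have A: "C_k 1 S (\<lambda>z. dir_deriv S f v z * g z)" "C_k 1 S (\<lambda>z. f z * dir_deriv S g v z)"
    by (rule C_1_mult[OF S D1(1) C1(2)], rule C_1_mult[OF S C1(1) D1(2)])
  have B: "C_k 1 S (\<lambda>z. (-1) * (f z * dir_deriv S g v z))"
    by (rule C_k_cmult[OF S A(2)])
  show "C_k 1 S P" unfolding P_def by (rule C_k_add[OF S A(1) B])
  have D: "h differentiable_on S" if "C_k 1 S h" for h :: "real^2 \<Rightarrow> real" using that by simp
  assume z: "z \<in> S"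
  have "dir_deriv S P v z = dir_deriv S (\<lambda>z. dir_deriv S f v z * g z) v z
      + (-1) * dir_deriv S (\<lambda>z. f z * dir_deriv S g v z) v z"
    unfolding P_def
    by (subst dir_deriv_add[OF S z D[OF A(1)] D[OF B]]) (subst dir_deriv_cmult[OF S z D[OF A(2)]], rule refl)
  then show "dir_deriv S P v z = dir_deriv S (dir_deriv S f v) v z * g z
      - f z * dir_deriv S (dir_deriv S g v) v z"
    by (simp add: dir_deriv_mult[OF S z D[OF D1(1)] D[OF C1(2)]]
        dir_deriv_mult[OF S z D[OF C1(1)] D[OF D1(2)]])
qed

text \<open>\<open>F\<close> and \<open>G\<close> are continuous extensions of Laplacians that are
  known only inside. This matters for f = \<Delta>u: its second derivatives need not exist on the
  boundary, but \<mu> u is such an extension of its Laplacian.\<close>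

lemma green:
  assumes f: "neumann f" and g: "neumann g"
    and F: "continuous_on Omega F" "\<And>z. z \<in> interior Omega \<Longrightarrow> laplacian Omega f z = F z"
    and G: "continuous_on Omega G" "\<And>z. z \<in> interior Omega \<Longrightarrow> laplacian Omega g z = G z"
  shows "integral Omega (\<lambda>z. F z * g z) = integral Omega (\<lambda>z. f z * G z)"
proof -
  let ?I = "interior Omega"
  \<comment> \<open>Taking \<open>S\<close> as a parameter separates two roles: derivatives within
    \<open>Omega\<close> give continuity and the boundary values, derivatives within the interior
    give C^1 regularity.\<close>
  define P where "P = (\<lambda>S i z. dir_deriv S f (axis i 1) z * g z + (-1) * (f z * dir_deriv S g (axis i 1) z))"
  note U = unique_derivatives_open[OF open_interior, of Omega]
  have C: "C_k 1 Omega f" "C_k 1 Omega g" "C_k 2 ?I f" "C_k 2 ?I g"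
    using f g by (auto simp: neumann_def)
  have cont: "continuous_on Omega f" "continuous_on Omega g"
    using C by (auto intro: differentiable_imp_continuous_on)
  have P_cont: "continuous_on Omega (P Omega i)" for i
    unfolding P_def using C cont by (auto intro!: continuous_intros)
  have P_I: "P ?I i z = P Omega i z" if "z \<in> ?I" for i z
    using that by (simp add: P_def dir_deriv_interior)
  have P_C: "C_k 1 ?I (P Omega i)" for i
    by (rule C_k_cong[OF P_I]) (use green_component(1)[OF U C(3,4), where v = "axis i 1"] in \<open>simp_all only: P_def\<close>)
  have P_D: "dir_deriv ?I (P Omega i) (axis i 1) z =
      dir_deriv ?I (dir_deriv ?I f (axis i 1)) (axis i 1) z * g z
      - f z * dir_deriv ?I (dir_deriv ?I g (axis i 1)) (axis i 1) z" if "z \<in> ?I" for i z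
    using green_component(2)[OF U C(3,4) that, where v = "axis i 1"]
      dir_deriv_cong[OF that P_I, where v = "axis i 1"] by (simp add: P_def)
  have "integral Omega (\<lambda>z. F z * g z - f z * G z) = 0"
  proof (rule divergence_Omega[OF P_cont[of 1] P_C[of 1] P_cont[of 2] P_C[of 2]])
    show "continuous_on Omega (\<lambda>z. F z * g z - f z * G z)"
      by (intro continuous_intros F G cont)
  next
    fix z assume z: "z \<in> ?I"
    then have "F z * g z - f z * G z = laplacian ?I f z * g z - f z * laplacian ?I g z"
      using F(2) G(2) by (simp add: laplacian_interior)
    also have "\<dots> = dir_deriv ?I (P Omega 1) (axis 1 1) z + dir_deriv ?I (P Omega 2) (axis 2 1) z"
      unfolding P_D[OF z] by (simp add: laplacian_2 algebra_simps)
    finally show "F z * g z - f z * G z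
        = dir_deriv ?I (P Omega 1) (axis 1 1) z + dir_deriv ?I (P Omega 2) (axis 2 1) z" .
  next
    fix z :: "real^2" assume z: "\<bar>z $ 1\<bar> = 1" "\<bar>z $ 2\<bar> < 1"
    then have "\<bar>z $ j\<bar> < 1" if "j \<noteq> 1" for j using that exhaust_2[of j] by auto
    then show "P Omega 1 z = 0"
      using neumann_D[OF f z(1)] neumann_D[OF g z(1)] by (simp add: P_def)
  next
    fix z :: "real^2" assume z: "\<bar>z $ 2\<bar> = 1" "\<bar>z $ 1\<bar> < 1"
    then have "\<bar>z $ j\<bar> < 1" if "j \<noteq> 2" for j using that exhaust_2[of j] by auto
    then show "P Omega 2 z = 0"
      using neumann_D[OF f z(1)] neumann_D[OF g z(1)] by (simp add: P_def)
  qed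
  moreover have "integral Omega (\<lambda>z. F z * g z - f z * G z)
      = integral Omega (\<lambda>z. F z * g z) - integral Omega (\<lambda>z. f z * G z)"
    by (intro integral_diff integrable_on_Omega continuous_intros F G cont)
  ultimately show ?thesis by simp
qed

subsection \<open>Cosine products\<close>

text \<open>The phases make this family closed under differentiation.\<close>

definition cosines :: "real \<Rightarrow> real \<Rightarrow> real \<Rightarrow> real \<Rightarrow> real^2 \<Rightarrow> real" where
  "cosines a \<phi> b \<psi> z = cos (a * (z $ 1 + 1) + \<phi>) * cos (b * (z $ 2 + 1) + \<psi>)"

lemma has_derivative_cosines:
  "(cosines a \<phi> b \<psi> has_derivative (\<lambda>v. a * v $ 1 * cosines a (\<phi> + pi/2) b \<psi> z
     + b * v $ 2 * cosines a \<phi> b (\<psi> + pi/2) z)) (at z within S)"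
proof -
  have shift: "cos (x + (y + pi/2)) = - sin (x + y)" for x y :: real
    using minus_sin_cos_eq[of "x + y"] by (simp add: add.assoc)
  have [derivative_intros]: "((\<lambda>z::real^2. z $ i) has_derivative (\<lambda>v. v $ i)) (at z within S)" for i
    by (rule bounded_linear.has_derivative[OF bounded_linear_vec_nth has_derivative_ident])
  show ?thesis
    unfolding cosines_def[abs_def] shift
    by (auto intro!: derivative_eq_intros simp: algebra_simps)
qed

lemma dir_deriv_cosines:
  assumes "unique_derivatives S" "z \<in> S"
  shows "dir_deriv S (cosines a \<phi> b \<psi>) v z
    = a * v $ 1 * cosines a (\<phi> + pi/2) b \<psi> z + b * v $ 2 * cosines a \<phi> b (\<psi> + pi/2) z"
  by (rule dir_deriv_eqI[OF assms has_derivative_cosines])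

lemma C_k_cosines:
  assumes "unique_derivatives S"
  shows "C_k k S (cosines a \<phi> b \<psi>)"
proof (induction k arbitrary: \<phi> \<psi>)
  case 0
  show ?case
    unfolding C_k.simps cosines_def[abs_def] by (intro continuous_intros)
next
  case (Suc k)
  have "C_k k S (dir_deriv S (cosines a \<phi> b \<psi>) v)" for v
    by (rule C_k_cong[OF dir_deriv_cosines[OF assms, symmetric]])
       (assumption, rule C_k_add[OF assms C_k_cmult[OF assms Suc] C_k_cmult[OF assms Suc]])
  moreover have "cosines a \<phi> b \<psi> differentiable_on S"
    unfolding differentiable_on_def using has_derivative_cosines by (blast intro: differentiableI)
  ultimately show ?case by simp
qed

text \<open>Two derivatives in one variable shift the phase by pi, which is a change of
  sign.\<close>

lemma laplacian_cosines:
  assumes "unique_derivatives S" "z \<in> S"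
  shows "laplacian S (cosines a \<phi> b \<psi>) z = - (a\<^sup>2 + b\<^sup>2) * cosines a \<phi> b \<psi> z"
proof -
  have "cos (x + (y + pi/2 + pi/2)) = - cos (x + y)" for x y :: real
    using cos_periodic_pi[of "x + y"] by (simp add: add.assoc)
  then have shift: "cosines a (\<phi> + pi/2 + pi/2) b \<psi> z = - cosines a \<phi> b \<psi> z"
    "cosines a \<phi> b (\<psi> + pi/2 + pi/2) z = - cosines a \<phi> b \<psi> z"
    by (simp_all only: cosines_def mult_minus_left mult_minus_right)
  have D: "cosines a' \<phi>' b' \<psi>' differentiable_on S" for a' \<phi>' b' \<psi>'
    using C_k_cosines[OF assms(1), of 1] by simp
  have "dir_deriv S (dir_deriv S (cosines a \<phi> b \<psi>) (axis 1 1)) (axis 1 1) z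
      = dir_deriv S (\<lambda>z. a * cosines a (\<phi> + pi/2) b \<psi> z) (axis 1 1) z"
    by (rule dir_deriv_cong[OF assms(2)]) (simp add: dir_deriv_cosines[OF assms(1)] axis_def)
  also have "\<dots> = - a\<^sup>2 * cosines a \<phi> b \<psi> z"
    unfolding dir_deriv_cmult[OF assms D] dir_deriv_cosines[OF assms] shift
    by (simp add: axis_def power2_eq_square)
  finally have 1: "dir_deriv S (dir_deriv S (cosines a \<phi> b \<psi>) (axis 1 1)) (axis 1 1) z
      = - a\<^sup>2 * cosines a \<phi> b \<psi> z" .
  have "dir_deriv S (dir_deriv S (cosines a \<phi> b \<psi>) (axis 2 1)) (axis 2 1) z
      = dir_deriv S (\<lambda>z. b * cosines a \<phi> b (\<psi> + pi/2) z) (axis 2 1) z"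
    by (rule dir_deriv_cong[OF assms(2)]) (simp add: dir_deriv_cosines[OF assms(1)] axis_def)
  also have "\<dots> = - b\<^sup>2 * cosines a \<phi> b \<psi> z"
    unfolding dir_deriv_cmult[OF assms D] dir_deriv_cosines[OF assms] shift
    by (simp add: axis_def power2_eq_square)
  finally show ?thesis
    using 1 by (simp add: laplacian_2 algebra_simps)
qed

text \<open>The eigenvalue \<lambda>_m of -\<Delta> on \<open>cos_product m\<close>; its square is
  the eigenvalue in (A) and (B).\<close>

definition frequency_sq :: "nat \<times> nat \<Rightarrow> real" where
  "frequency_sq m = (pi * real (fst m) / 2)\<^sup>2 + (pi * real (snd m) / 2)\<^sup>2"

lemma cos_product_eq_cosines:
  "cos_product m = cosines (pi * real (fst m) / 2) 0 (pi * real (snd m) / 2) 0"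
  by (simp add: fun_eq_iff cos_product_def cosines_def)

lemma C_k_cos_product: "unique_derivatives S \<Longrightarrow> C_k k S (cos_product m)"
  unfolding cos_product_eq_cosines by (rule C_k_cosines)

lemma laplacian_cos_product:
  "unique_derivatives S \<Longrightarrow> z \<in> S \<Longrightarrow>
    laplacian S (cos_product m) z = - frequency_sq m * cos_product m z"
  unfolding cos_product_eq_cosines frequency_sq_def by (rule laplacian_cosines)

lemma bilaplacian_cos_product:
  assumes "unique_derivatives S" "z \<in> S"
  shows "bilaplacian S (cos_product m) z = (frequency_sq m)\<^sup>2 * cos_product m z"
proof -
  have "bilaplacian S (cos_product m) z = laplacian S (\<lambda>z. - frequency_sq m * cos_product m z) z"
    unfolding bilaplacian_def
    by (rule laplacian_cong[OF assms(2)]) (rule laplacian_cos_product[OF assms(1)])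
  also have "\<dots> = - frequency_sq m * laplacian S (cos_product m) z"
    by (rule laplacian_cmult[OF assms C_k_cos_product[OF assms(1)]])
  finally show ?thesis
    by (simp add: laplacian_cos_product[OF assms] power2_eq_square)
qed

text \<open>On a side the coordinate plus 1 is 0 or 2, so the differentiated factor is a sine at an
  integer multiple of pi. This is where the frequencies pi n / 2 come from.\<close>

lemma normal_derivative_cos_product:
  assumes "z \<in> smooth_boundary Omega"
  shows "dir_deriv Omega (cos_product m) (normal Omega z) z = 0"
proof -
  obtain i where i: "\<bar>z $ i\<bar> = 1" "\<And>j. j \<noteq> i \<Longrightarrow> \<bar>z $ j\<bar> < 1"
    using assms by (auto simp: smooth_boundary_Omega_iff)
  have z: "z \<in> Omega"
    using assms by (auto simp: smooth_boundary_def frontier_Omega)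
  have sin0: "cos (pi * real n / 2 * (x + 1) + pi/2) = 0" if "\<bar>x\<bar> = 1" for x n
    using that minus_sin_cos_eq[of "pi * real n / 2 * (x + 1)"]
    by (auto simp: abs_if mult.commute[of pi] split: if_splits)
  have n: "normal Omega z = axis i (z $ i)" using i by (rule normal_Omega)
  show ?thesis
    unfolding cos_product_eq_cosines dir_deriv_cosines[OF unique_derivatives_Omega z] n
    using exhaust_2[of i] i(1) sin0[of "z $ i"]
    by (auto simp: cosines_def axis_def)
qed

lemma neumann_cos_product: "neumann (cos_product m)"
  unfolding neumann_def
  using C_k_cos_product[OF unique_derivatives_Omega] normal_derivative_cos_product
    C_k_cos_product[OF unique_derivatives_open[OF open_interior]] by blast

lemma solves_B_cos_product: "solves_B Omega ((frequency_sq m)\<^sup>2) (cos_product m)"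
proof -
  have "dir_deriv Omega (laplacian Omega (cos_product m)) (normal Omega z) z = 0"
    if z: "z \<in> smooth_boundary Omega" for z
  proof -
    have "z \<in> Omega" using z by (auto simp: smooth_boundary_def frontier_Omega)
    have "dir_deriv Omega (laplacian Omega (cos_product m)) (normal Omega z) z
        = dir_deriv Omega (\<lambda>z. - frequency_sq m * cos_product m z) (normal Omega z) z"
      by (rule dir_deriv_cong[OF \<open>z \<in> Omega\<close>]) (rule laplacian_cos_product[OF unique_derivatives_Omega])
    also have "\<dots> = - frequency_sq m * dir_deriv Omega (cos_product m) (normal Omega z) z"
      by (rule dir_deriv_cmult[OF unique_derivatives_Omega \<open>z \<in> Omega\<close>
            C_k_2_D(1)[OF C_k_cos_product[OF unique_derivatives_Omega]]])
    finally show ?thesis by (simp add: normal_derivative_cos_product[OF z])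
  qed
  then show ?thesis
    unfolding solves_B_def
    using C_k_cos_product[OF unique_derivatives_Omega] normal_derivative_cos_product
      C_k_cos_product[OF unique_derivatives_open[OF open_interior]]
      bilaplacian_cos_product[OF unique_derivatives_Omega] interior_subset[of Omega]
    by blast
qed

section \<open>Orthonormality of the cosine basis\<close>

lemma continuous_on_cos_product: "continuous_on S (cos_product m)"
  unfolding cos_product_def[abs_def] by (intro continuous_intros)

lemma continuous_on_cos_basis: "continuous_on S (cos_basis m)"
  unfolding cos_basis_def[abs_def] by (intro continuous_intros continuous_on_cos_product)

text \<open>The index is an integer so that both the difference and the sum of two frequencies are
  covered. For k \<noteq> 0 the antiderivative is a multiple of a sine, which is zero at 0 and at pi
  k.\<close>

lemma integral_cos_multiple:
  "integral {-1..1} (\<lambda>t. cos (pi * of_int k / 2 * (t + 1))) = (if k = 0 then 2 else 0)"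
proof (cases "k = 0")
  case False
  let ?a = "pi * of_int k / 2 :: real"
  have "((\<lambda>t. cos (?a * (t + 1))) has_integral (sin (?a * (1 + 1)) / ?a - sin (?a * (-1 + 1)) / ?a)) {-1..1}"
    using False
    by (intro fundamental_theorem_of_calculus)
       (auto simp flip: has_real_derivative_iff_has_vector_derivative intro!: derivative_eq_intros)
  moreover have "sin (?a * (1 + 1)) = 0"
    using sin_times_pi_eq_0[of "of_int k"] by (simp add: mult.commute)
  ultimately show ?thesis using False by (simp add: integral_unique)
qed simp

lemma cos_product_to_sum:
  "cos (pi * real m / 2 * t) * cos (pi * real n / 2 * t)
   = (cos (pi * of_int (int m - int n) / 2 * t) + cos (pi * of_int (int m + int n) / 2 * t)) / 2"
  by (simp add: cos_times_cos algebra_simps diff_divide_distrib add_divide_distrib)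

lemma integral_cos_cos:
  "integral {-1..1} (\<lambda>t. cos (pi * real m / 2 * (t + 1)) * cos (pi * real n / 2 * (t + 1)))
   = (if m = n then if m = 0 then 2 else 1 else 0)"
proof -
  have "integral {-1..1} (\<lambda>t. cos (pi * real m / 2 * (t + 1)) * cos (pi * real n / 2 * (t + 1)))
    = (integral {-1..1} (\<lambda>t. cos (pi * of_int (int m - int n) / 2 * (t + 1)))
      + integral {-1..1} (\<lambda>t. cos (pi * of_int (int m + int n) / 2 * (t + 1)))) / 2"
    unfolding cos_product_to_sum
    by (subst integral_add[symmetric])
       (auto intro!: integrable_continuous_interval continuous_intros)
  \<comment> \<open>The difference contributes 2 when m = n, the sum only when both indices are 0;
    halving gives 1, or 2 in the latter case.\<close>
  also have "\<dots> = (if m = n then if m = 0 then 2 else 1 else 0)"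
    unfolding integral_cos_multiple by auto
  finally show ?thesis .
qed

lemma integral_Omega_times:
  fixes f g :: "real \<Rightarrow> real"
  assumes "continuous_on {-1..1} f" "continuous_on {-1..1} g"
  shows "integral Omega (\<lambda>z. f (z $ 1) * g (z $ 2)) = integral {-1..1} f * integral {-1..1} g"
proof -
  have "continuous_on Omega (\<lambda>z. f (z $ 1) * g (z $ 2))"
    by (intro continuous_intros continuous_on_compose2[OF assms(1)] continuous_on_compose2[OF assms(2)])
       (auto simp: Omega_iff abs_le_iff)
  from integral_Omega(1)[OF this] show ?thesis by simp
qed

text \<open>The squared norm is 4, 2 or 1 when two, one or none of the indices are zero, so
  \<open>cos_const\<close> takes the values 1/2, 1/sqrt 2 and 1.\<close>

lemma integral_cos_product_cos_product:
  "integral Omega (\<lambda>z. cos_product m z * cos_product n z)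
   = (if m = n then (if fst m = 0 then 2 else 1) * (if snd m = 0 then 2 else 1) else 0)"
proof -
  let ?c = "\<lambda>k l t. cos (pi * real k / 2 * (t + 1)) * cos (pi * real l / 2 * (t + 1))"
  have "integral Omega (\<lambda>z. cos_product m z * cos_product n z)
      = integral Omega (\<lambda>z. ?c (fst m) (fst n) (z $ 1) * ?c (snd m) (snd n) (z $ 2))"
    by (simp add: cos_product_def mult_ac)
  also have "\<dots> = integral {-1..1} (?c (fst m) (fst n)) * integral {-1..1} (?c (snd m) (snd n))"
    by (intro integral_Omega_times continuous_intros)
  finally show ?thesis
    unfolding integral_cos_cos by (auto simp: prod_eq_iff)
qed

lemma set_integrable_Omega: "continuous_on Omega f \<Longrightarrow> set_integrable lebesgue Omega f"
  for f :: "real^2 \<Rightarrow> real"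
  unfolding Omega_def by (rule absolutely_integrable_continuous)

lemma L2_inner_eq_integral:
  assumes "continuous_on Omega f" "continuous_on Omega g"
  shows "L2_inner Omega f g = integral Omega (\<lambda>z. f z * g z)"
  unfolding L2_inner_def
  by (intro set_lebesgue_integral_eq_integral set_integrable_Omega continuous_intros assms)

lemma cos_const_sq:
  "(cos_const m)\<^sup>2 * integral Omega (\<lambda>z. cos_product m z * cos_product m z) = 1"
  "cos_const m \<noteq> 0"
  by (simp_all add: cos_const_def L2_norm_def L2_inner_eq_integral continuous_on_cos_product
      integral_cos_product_cos_product power_divide)

lemma L2_inner_cos_basis: "L2_inner Omega (cos_basis m) (cos_basis n) = (if m = n then 1 else 0)"
proof -
  have "L2_inner Omega (cos_basis m) (cos_basis n)
      = integral Omega (\<lambda>z. (cos_const m * cos_const n) * (cos_product m z * cos_product n z))"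
    unfolding L2_inner_eq_integral[OF continuous_on_cos_basis continuous_on_cos_basis]
    by (simp add: cos_basis_def mult_ac)
  also have "\<dots> = (cos_const m * cos_const n) * integral Omega (\<lambda>z. cos_product m z * cos_product n z)"
    by (rule integral_mult_right)
  finally show ?thesis
    using cos_const_sq(1)[of m] by (auto simp: power2_eq_square integral_cos_product_cos_product)
qed

lemma square_integrable_continuous:
  assumes "continuous_on Omega f"
  shows "square_integrable Omega f"
  unfolding square_integrable_def
proof
  show "set_borel_measurable lebesgue Omega f"
    using set_integrable_Omega[OF assms] unfolding set_integrable_def set_borel_measurable_def
    by (rule borel_measurable_integrable)
  show "set_integrable lebesgue Omega (\<lambda>z. (f z)\<^sup>2)"
    by (intro set_integrable_Omega continuous_intros assms)
qed

section \<open>The algebra of cosine polynomials and its uniform density\<close>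

text \<open>Index set and coefficients are spelled out to match \<open>orthonormal_basis\<close>;
  the elements are functions on the whole plane, so that closure properties reduce to equations
  between functions.\<close>

definition cos_span :: "(real^2 \<Rightarrow> real) set" where
  "cos_span = {f. \<exists>F a. finite F \<and> f = (\<lambda>z. \<Sum>m\<in>F. a m * cos_basis m z)}"

lemma cos_spanI: "finite F \<Longrightarrow> (\<lambda>z. \<Sum>m\<in>F. a m * cos_basis m z) \<in> cos_span"
  unfolding cos_span_def by (intro CollectI exI conjI) (assumption, rule refl)

lemma cos_span_add:
  assumes "f \<in> cos_span" "g \<in> cos_span"
  shows "(\<lambda>z. f z + g z) \<in> cos_span"
proof -
  obtain F a G b where f: "finite F" "f = (\<lambda>z. \<Sum>m\<in>F. a m * cos_basis m z)"
    and g: "finite G" "g = (\<lambda>z. \<Sum>m\<in>G. b m * cos_basis m z)"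
    using assms by (auto simp: cos_span_def)
  \<comment> \<open>Coefficients are extended by 0 to the union, so that overlapping indices add
    up.\<close>
  have "(\<lambda>z. f z + g z) = (\<lambda>z. \<Sum>m\<in>F \<union> G.
      ((if m \<in> F then a m else 0) + (if m \<in> G then b m else 0)) * cos_basis m z)"
    using f(1) g(1) unfolding f(2) g(2)
    by (simp add: fun_eq_iff distrib_right sum.distrib if_distrib[of "\<lambda>x. x * _"] sum.If_cases
        Int_absorb1 cong: if_cong)
  also have "\<dots> \<in> cos_span" using f(1) g(1) by (intro cos_spanI) simp
  finally show ?thesis .
qed

lemma cos_span_cmult:
  assumes "f \<in> cos_span"
  shows "(\<lambda>z. c * f z) \<in> cos_span"
proof -
  obtain F a where f: "finite F" "f = (\<lambda>z. \<Sum>m\<in>F. a m * cos_basis m z)"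
    using assms by (auto simp: cos_span_def)
  have "(\<lambda>z. c * f z) = (\<lambda>z. \<Sum>m\<in>F. (c * a m) * cos_basis m z)"
    unfolding f(2) by (simp add: sum_distrib_left mult.assoc)
  also have "\<dots> \<in> cos_span" by (rule cos_spanI[OF f(1)])
  finally show ?thesis .
qed

lemma cos_span_sum:
  assumes "finite F" "\<And>m. m \<in> F \<Longrightarrow> f m \<in> cos_span"
  shows "(\<lambda>z. \<Sum>m\<in>F. f m z) \<in> cos_span"
  using assms
proof (induction F rule: finite_induct)
  case empty
  show ?case using cos_spanI[of "{}"] by simp
next
  case (insert x F)
  then show ?case using cos_span_add[of "f x" "\<lambda>z. \<Sum>m\<in>F. f m z"] by simp
qed

lemma cos_span_cos_product: "cos_product m \<in> cos_span"
proof -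
  have "cos_product m = (\<lambda>z. \<Sum>k\<in>{m}. (1 / cos_const k) * cos_basis k z)"
    using cos_const_sq(2)[of m] by (simp add: fun_eq_iff cos_basis_def)
  also have "\<dots> \<in> cos_span" by (rule cos_spanI) simp
  finally show ?thesis .
qed

text \<open>max - min is \<bar>m - n\<bar> without leaving the natural numbers; cosine is even, so
  the difference term again belongs to the family. This keeps the span closed under
  products.\<close>

lemma cos_product_to_sum_nat:
  "cos (pi * real m / 2 * t) * cos (pi * real n / 2 * t)
   = (cos (pi * real (max m n - min m n) / 2 * t) + cos (pi * real (m + n) / 2 * t)) / 2"
proof -
  have "cos (pi * of_int (int m - int n) / 2 * t) = cos (pi * real (max m n - min m n) / 2 * t)"
  proof (cases "n \<le> m")
    case False
    then have "pi * real (max m n - min m n) / 2 * t = - (pi * of_int (int m - int n) / 2 * t)"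
      by (simp add: max_def min_def of_nat_diff algebra_simps diff_divide_distrib)
    then show ?thesis by (metis cos_minus)
  qed (simp add: max_def min_def of_nat_diff)
  then show ?thesis unfolding cos_product_to_sum by simp
qed

lemma cos_span_cos_product_mult: "(\<lambda>z. cos_product m z * cos_product n z) \<in> cos_span"
proof -
  let ?d = "\<lambda>i j::nat. max i j - min i j"
  let ?m1 = "fst m" and ?m2 = "snd m" and ?n1 = "fst n" and ?n2 = "snd n"
  have "(\<lambda>z. cos_product m z * cos_product n z) = (\<lambda>z. (1/4) *
      (cos_product (?d ?m1 ?n1, ?d ?m2 ?n2) z + cos_product (?d ?m1 ?n1, ?m2 + ?n2) z
       + (cos_product (?m1 + ?n1, ?d ?m2 ?n2) z + cos_product (?m1 + ?n1, ?m2 + ?n2) z)))"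
  proof
    fix z
    let ?c = "\<lambda>k t. cos (pi * real k / 2 * (t + 1))"
    have expand: "(A + B) / 2 * ((C + D) / 2) = (1/4) * (A * C + A * D + (B * C + B * D))"
      for A B C D :: real by (simp add: algebra_simps)
    have "cos_product m z * cos_product n z
        = (?c ?m1 (z $ 1) * ?c ?n1 (z $ 1)) * (?c ?m2 (z $ 2) * ?c ?n2 (z $ 2))"
      by (simp add: cos_product_def)
    also have "\<dots> = (?c (?d ?m1 ?n1) (z $ 1) + ?c (?m1 + ?n1) (z $ 1)) / 2
        * ((?c (?d ?m2 ?n2) (z $ 2) + ?c (?m2 + ?n2) (z $ 2)) / 2)"
      by (simp only: cos_product_to_sum_nat)
    finally show "cos_product m z * cos_product n z = (1/4) *
      (cos_product (?d ?m1 ?n1, ?d ?m2 ?n2) z + cos_product (?d ?m1 ?n1, ?m2 + ?n2) z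
       + (cos_product (?m1 + ?n1, ?d ?m2 ?n2) z + cos_product (?m1 + ?n1, ?m2 + ?n2) z))"
      unfolding cos_product_def fst_conv snd_conv expand .
  qed
  then show ?thesis
    by (simp only:) (intro cos_span_cmult cos_span_add cos_span_cos_product)
qed

lemma cos_span_mult:
  assumes "f \<in> cos_span" "g \<in> cos_span"
  shows "(\<lambda>z. f z * g z) \<in> cos_span"
proof -
  obtain F a G b where f: "finite F" "f = (\<lambda>z. \<Sum>m\<in>F. a m * cos_basis m z)"
    and g: "finite G" "g = (\<lambda>z. \<Sum>m\<in>G. b m * cos_basis m z)"
    using assms by (auto simp: cos_span_def)
  have "(\<lambda>z. f z * g z) = (\<lambda>z. \<Sum>m\<in>F. \<Sum>n\<in>G.
      (a m * cos_const m * (b n * cos_const n)) * (cos_product m z * cos_product n z))"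
    unfolding f(2) g(2) sum_product by (simp add: cos_basis_def mult_ac)
  then show ?thesis
    using f(1) g(1) by (simp only:) (intro cos_span_sum cos_span_cmult cos_span_cos_product_mult)
qed

lemma continuous_on_cos_span: "f \<in> cos_span \<Longrightarrow> continuous_on S f"
  unfolding cos_span_def by (auto intro!: continuous_intros continuous_on_cos_basis)

lemma cos_span_const: "(\<lambda>z. c) \<in> cos_span"
  using cos_span_cmult[OF cos_span_cos_product[of "(0, 0)"], of c]
  by (simp add: cos_product_def[abs_def])

text \<open>The span is an algebra containing the constants, and single coordinates separate points:
  on [-1, 1] the argument pi/2 (x + 1) runs through [0, pi], where cosine is injective.\<close>

lemma cos_span_dense:
  assumes "continuous_on Omega f" "\<epsilon> > 0"
  shows "\<exists>g\<in>cos_span. \<forall>z\<in>Omega. \<bar>f z - g z\<bar> < \<epsilon>"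
proof -
  have inj: "x = y" if "cos (pi / 2 * (x + 1)) = cos (pi / 2 * (y + 1))" "\<bar>x\<bar> \<le> 1" "\<bar>y\<bar> \<le> 1" for x y
  proof -
    have "0 \<le> pi / 2 * (t + 1) \<and> pi / 2 * (t + 1) \<le> pi" if "\<bar>t\<bar> \<le> 1" for t
      using that mult_left_mono[of "t + 1" 2 "pi / 2"] by (auto simp: abs_le_iff)
    from cos_inj_pi[OF _ _ _ _ that(1)] this[OF that(2)] this[OF that(3)]
    have "pi / 2 * (x + 1) = pi / 2 * (y + 1)" by blast
    then show ?thesis by simp
  qed
  have "\<exists>g. g \<in> cos_span \<and> (\<forall>z\<in>Omega. \<bar>f z - g z\<bar> < \<epsilon>)"
  proof (rule Stone_Weierstrass_HOL[where P = "\<lambda>g. g \<in> cos_span", OF compact_Omega])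
    fix x y :: "real^2" assume xy: "x \<in> Omega \<and> y \<in> Omega \<and> x \<noteq> y"
    then obtain i where "x $ i \<noteq> y $ i" by (auto simp: vec_eq_iff)
    then have "cos_product (1, 0) x \<noteq> cos_product (1, 0) y \<or> cos_product (0, 1) x \<noteq> cos_product (0, 1) y"
      using exhaust_2[of i] inj[of "x $ i" "y $ i"] xy by (auto simp: cos_product_def Omega_iff)
    then show "\<exists>g. g \<in> cos_span \<and> g x \<noteq> g y" using cos_span_cos_product by blast
  qed (use assms in \<open>auto intro: cos_span_const cos_span_add cos_span_mult continuous_on_cos_span\<close>)
  then show ?thesis by blast
qed

subsection \<open>Density in $L^2$\<close>

text \<open>Truncation at height k makes \<open>f\<close> bounded at small cost. Continuous
  functions converging to \<open>f\<close> almost everywhere on \<open>S\<close> are truncated at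
  the same height, so on a set of finite measure dominated convergence applies with the constant
  bound (2k)^2. Note that \<epsilon> bounds the squared distance.\<close>

lemma square_integrable_approx_continuous:
  assumes S: "S \<in> lmeasurable" and f: "square_integrable S f" and "\<epsilon> > 0"
  shows "\<exists>g. continuous_on UNIV g \<and> set_integrable lebesgue S (\<lambda>z. (f z - g z)\<^sup>2)
    \<and> (LINT z:S|lebesgue. (f z - g z)\<^sup>2) < \<epsilon>"
proof -
  define f0 where "f0 = (\<lambda>z. indicator S z * f z)"
  define clamp where "clamp = (\<lambda>(k::nat) y::real. max (- real k) (min (real k) y))"
  have S_sets [measurable]: "S \<in> sets lebesgue" using S by (rule fmeasurableD)
  have f0_meas [measurable]: "f0 \<in> borel_measurable lebesgue"
    using f by (simp add: f0_def square_integrable_def set_borel_measurable_def)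
  have f0_sq: "integrable lebesgue (\<lambda>z. (f0 z)\<^sup>2)"
  proof -
    have "(\<lambda>z. (f0 z)\<^sup>2) = (\<lambda>z. indicator S z *\<^sub>R (f z)\<^sup>2)"
      by (auto simp: f0_def fun_eq_iff indicator_def)
    then show ?thesis using f by (simp add: square_integrable_def set_integrable_def)
  qed
  have clamp_meas [measurable]: "clamp k \<in> borel_measurable borel" for k
    unfolding clamp_def by measurable
  have clamp_diff: "\<bar>y - clamp k y\<bar> \<le> \<bar>y\<bar>" for k y by (auto simp: clamp_def)
  have trunc_bound: "norm ((f0 z - clamp k (f0 z))\<^sup>2) \<le> (f0 z)\<^sup>2" for k z
    using clamp_diff[of "f0 z" k] by (simp add: abs_le_square_iff)
  have "(\<lambda>k. LINT z|lebesgue. (f0 z - clamp k (f0 z))\<^sup>2) \<longlonglongrightarrow> (LINT z|(lebesgue :: (real^2) measure). 0)"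
  proof (rule integral_dominated_convergence[OF _ _ f0_sq])
    have "(\<lambda>k. (f0 z - clamp k (f0 z))\<^sup>2) \<longlonglongrightarrow> 0" for z
    proof (rule tendsto_eventually)
      obtain n where "\<bar>f0 z\<bar> \<le> real n" using real_arch_simple by blast
      then have "(f0 z - clamp k (f0 z))\<^sup>2 = 0" if "k \<ge> n" for k
        using that by (auto simp: clamp_def)
      then show "\<forall>\<^sub>F k in sequentially. (f0 z - clamp k (f0 z))\<^sup>2 = 0"
        by (auto simp: eventually_sequentially)
    qed
    then show "AE z in lebesgue. (\<lambda>k. (f0 z - clamp k (f0 z))\<^sup>2) \<longlonglongrightarrow> 0" by simp
  qed (use trunc_bound in \<open>auto\<close>)
  \<comment> \<open>Two errors below \<epsilon>/4, each doubled by (a + b)^2 \<le> 2 a^2 + 2 b^2,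
    add up to less than \<epsilon>.\<close>
  then have "\<forall>\<^sub>F k in sequentially. (LINT z|lebesgue. (f0 z - clamp k (f0 z))\<^sup>2) < \<epsilon> / 4"
    using \<open>\<epsilon> > 0\<close> by (intro order_tendstoD(2)[where y = 0]) auto
  then obtain k where k: "(LINT z|lebesgue. (f0 z - clamp k (f0 z))\<^sup>2) < \<epsilon> / 4"
    by (auto simp: eventually_sequentially)
  have k_int: "integrable lebesgue (\<lambda>z. (f0 z - clamp k (f0 z))\<^sup>2)"
    by (rule Bochner_Integration.integrable_bound[OF f0_sq]) (use trunc_bound in auto)
  \<comment> \<open>Lebesgue measurability, in its equivalent form as an almost everywhere limit of
    continuous functions, supplies the approximants.\<close>
  have "f0 measurable_on UNIV"
    by (rule lebesgue_measurable_imp_measurable_on) simp_all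
  then obtain N g where N: "negligible N" and g: "\<And>n. continuous_on UNIV (g n)"
    and lim: "\<And>z. z \<notin> N \<Longrightarrow> (\<lambda>n. g n z) \<longlonglongrightarrow> f0 z"
    by (auto simp: measurable_on_def)
  have g_meas [measurable]: "g n \<in> borel_measurable lebesgue" for n
    using borel_measurable_continuous_onI[OF g[of n]] by (intro measurable_completion) simp
  have cont_clamp: "continuous_on A (clamp k)" for A
    unfolding clamp_def by (intro continuous_intros)
  have ind_int: "integrable lebesgue (\<lambda>z. indicator S z * (2 * real k)\<^sup>2)"
    using S by (simp add: integrable_real_indicator fmeasurable_def)
  have dist_bound: "norm (indicator S z * (clamp k (f0 z) - clamp k (g n z))\<^sup>2)
      \<le> indicator S z * (2 * real k)\<^sup>2" for n z
  proof -
    have "\<bar>clamp k (f0 z) - clamp k (g n z)\<bar> \<le> \<bar>2 * real k\<bar>" by (auto simp: clamp_def)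
    then have "(clamp k (f0 z) - clamp k (g n z))\<^sup>2 \<le> (2 * real k)\<^sup>2" by (simp only: abs_le_square_iff)
    then show ?thesis by (auto simp: indicator_def)
  qed
  have "(\<lambda>n. LINT z|lebesgue. indicator S z * (clamp k (f0 z) - clamp k (g n z))\<^sup>2)
      \<longlonglongrightarrow> (LINT z|(lebesgue :: (real^2) measure). 0)"
  proof (rule integral_dominated_convergence[OF _ _ ind_int])
    have "(\<lambda>n. indicator S z * (clamp k (f0 z) - clamp k (g n z))\<^sup>2) \<longlonglongrightarrow> 0" if "z \<notin> N" for z
    proof -
      have "(\<lambda>n. clamp k (g n z)) \<longlonglongrightarrow> clamp k (f0 z)"
        by (rule continuous_on_tendsto_compose[OF cont_clamp[of UNIV] lim[OF that]]) simp_all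
      then have "(\<lambda>n. indicator S z * (clamp k (f0 z) - clamp k (g n z))\<^sup>2)
          \<longlonglongrightarrow> indicator S z * (clamp k (f0 z) - clamp k (f0 z))\<^sup>2"
        by (intro tendsto_intros)
      then show ?thesis by simp
    qed
    then show "AE z in lebesgue. (\<lambda>n. indicator S z * (clamp k (f0 z) - clamp k (g n z))\<^sup>2) \<longlonglongrightarrow> 0"
      using N by (intro AE_I'[of N]) (auto simp: negligible_iff_null_sets)
  qed (use dist_bound in \<open>auto\<close>)
  then have "\<forall>\<^sub>F n in sequentially.
      (LINT z|lebesgue. indicator S z * (clamp k (f0 z) - clamp k (g n z))\<^sup>2) < \<epsilon> / 4"
    using \<open>\<epsilon> > 0\<close> by (intro order_tendstoD(2)[where y = 0]) auto
  then obtain n where n: "(LINT z|lebesgue. indicator S z * (clamp k (f0 z) - clamp k (g n z))\<^sup>2) < \<epsilon> / 4"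
    by (auto simp: eventually_sequentially)
  have n_int: "integrable lebesgue (\<lambda>z. indicator S z * (clamp k (f0 z) - clamp k (g n z))\<^sup>2)"
    by (rule Bochner_Integration.integrable_bound[OF ind_int]) (use dist_bound in auto)
  define h where "h = (\<lambda>z. clamp k (g n z))"
  define bound where "bound = (\<lambda>z. 2 * (f0 z - clamp k (f0 z))\<^sup>2
    + 2 * (indicator S z * (clamp k (f0 z) - clamp k (g n z))\<^sup>2))"
  have bound_int: "integrable lebesgue bound"
    unfolding bound_def using k_int n_int by simp
  have le_bound: "indicator S z *\<^sub>R (f z - h z)\<^sup>2 \<le> bound z" for z
  proof (cases "z \<in> S")
    case True
    have "(x - y)\<^sup>2 \<le> 2 * (x - t)\<^sup>2 + 2 * (t - y)\<^sup>2" for x y t :: real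
      using zero_le_power2[of "(x - t) - (t - y)"] by (simp add: power2_eq_square algebra_simps)
    from this[of "f z" "h z" "clamp k (f z)"] True show ?thesis
      by (simp add: bound_def h_def f0_def)
  qed (simp add: bound_def)
  have bound_nonneg: "0 \<le> bound z" for z by (simp add: bound_def)
  have eq: "indicator S z *\<^sub>R (f z - h z)\<^sup>2 = indicator S z * (f0 z - h z)\<^sup>2" for z
    by (auto simp: f0_def indicator_def)
  have int: "integrable lebesgue (\<lambda>z. indicator S z *\<^sub>R (f z - h z)\<^sup>2)"
  proof (rule Bochner_Integration.integrable_bound[OF bound_int])
    show "(\<lambda>z. indicator S z *\<^sub>R (f z - h z)\<^sup>2) \<in> borel_measurable lebesgue"
      unfolding eq unfolding h_def by measurable
    show "AE z in lebesgue. norm (indicator S z *\<^sub>R (f z - h z)\<^sup>2) \<le> norm (bound z)"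
      using le_bound bound_nonneg by (auto simp: abs_mult)
  qed
  have "(LINT z:S|lebesgue. (f z - h z)\<^sup>2) \<le> (LINT z|lebesgue. bound z)"
    unfolding set_lebesgue_integral_def by (intro integral_mono int bound_int le_bound)
  also have "\<dots> < \<epsilon>"
    unfolding bound_def using k_int n_int k n by simp
  finally have "(LINT z:S|lebesgue. (f z - h z)\<^sup>2) < \<epsilon>" .
  moreover have "continuous_on UNIV h"
    unfolding h_def by (rule continuous_on_compose2[OF cont_clamp[of UNIV] g]) simp
  ultimately show ?thesis using int by (auto simp: set_integrable_def)
qed

lemma integral_Omega_const: "integral Omega (\<lambda>z. c) = 4 * c" for c :: real
proof -
  have "measure lborel Omega = 4"
    by (simp add: Omega_def content_cbox_if_cart interval_eq_empty_cart forall_2 UNIV_2)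
  then show ?thesis unfolding Omega_def by simp
qed

lemma cos_basis_dense:
  assumes f: "square_integrable Omega f" and "\<epsilon> > 0"
  shows "\<exists>F a. finite F \<and> L2_norm Omega (\<lambda>z. f z - (\<Sum>m\<in>F. a m * cos_basis m z)) < \<epsilon>"
proof -
  have "Omega \<in> lmeasurable" by (simp add: Omega_def)
  \<comment> \<open>With uniform error \<epsilon>/4 in the second approximation and area 4, the
    squared distance stays below 2 \<epsilon>^2/8 + 4 \<epsilon>^2/8 = 3/4 \<epsilon>^2.\<close>
  moreover have "\<epsilon>\<^sup>2 / 8 > 0" using \<open>\<epsilon> > 0\<close> by simp
  ultimately obtain g where g: "continuous_on UNIV g" "set_integrable lebesgue Omega (\<lambda>z. (f z - g z)\<^sup>2)"
    "(LINT z:Omega|lebesgue. (f z - g z)\<^sup>2) < \<epsilon>\<^sup>2 / 8"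
    using square_integrable_approx_continuous[OF _ f] by blast
  have "continuous_on Omega g" using g(1) by (rule continuous_on_subset) simp
  then obtain p where p: "p \<in> cos_span" "\<And>z. z \<in> Omega \<Longrightarrow> \<bar>g z - p z\<bar> < \<epsilon> / 4"
    using cos_span_dense[of g "\<epsilon> / 4"] \<open>\<epsilon> > 0\<close> by auto
  have const_int: "set_integrable lebesgue Omega (\<lambda>z. \<epsilon>\<^sup>2 / 8)"
    by (intro set_integrable_Omega continuous_intros)
  have le: "(f z - p z)\<^sup>2 \<le> 2 * (f z - g z)\<^sup>2 + \<epsilon>\<^sup>2 / 8" if "z \<in> Omega" for z
  proof -
    have "(x - y)\<^sup>2 \<le> 2 * (x - t)\<^sup>2 + 2 * (t - y)\<^sup>2" for x y t :: real
      using zero_le_power2[of "(x - t) - (t - y)"] by (simp add: power2_eq_square algebra_simps)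
    from this[of "f z" "p z" "g z"] have "(f z - p z)\<^sup>2 \<le> 2 * (f z - g z)\<^sup>2 + 2 * (g z - p z)\<^sup>2" .
    moreover have "(g z - p z)\<^sup>2 \<le> (\<epsilon> / 4)\<^sup>2"
      using p(2)[OF that] \<open>\<epsilon> > 0\<close> by (intro power2_le_iff_abs_le[THEN iffD2]) auto
    ultimately show ?thesis by (simp add: power_divide)
  qed
  have bound_int: "set_integrable lebesgue Omega (\<lambda>z. 2 * (f z - g z)\<^sup>2 + \<epsilon>\<^sup>2 / 8)"
    by (intro set_integral_add set_integrable_mult_right g(2) const_int)
  have "(LINT z:Omega|lebesgue. (f z - p z)\<^sup>2) \<le> (LINT z:Omega|lebesgue. 2 * (f z - g z)\<^sup>2 + \<epsilon>\<^sup>2 / 8)"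
    unfolding set_lebesgue_integral_def
    by (rule integral_mono') (use bound_int le in \<open>auto simp: set_integrable_def indicator_def\<close>)
  also have "\<dots> = 2 * (LINT z:Omega|lebesgue. (f z - g z)\<^sup>2) + (LINT z:Omega|lebesgue. \<epsilon>\<^sup>2 / 8)"
    using set_integral_add(2)[OF set_integrable_mult_right[of 2, OF g(2)] const_int] by simp
  also have "(LINT z:Omega|lebesgue. \<epsilon>\<^sup>2 / 8) = \<epsilon>\<^sup>2 / 2"
    by (simp only: set_lebesgue_integral_eq_integral(2)[OF const_int] integral_Omega_const)
  finally have "(LINT z:Omega|lebesgue. (f z - p z)\<^sup>2) < \<epsilon>\<^sup>2"
    using g(3) \<open>\<epsilon>\<^sup>2 / 8 > 0\<close> by linarith
  then have "L2_norm Omega (\<lambda>z. f z - p z) < \<epsilon>"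
    using \<open>\<epsilon> > 0\<close> unfolding L2_norm_def L2_inner_def
    by (simp add: power2_eq_square real_less_lsqrt)
  then show ?thesis using p(1) by (auto simp: cos_span_def)
qed

subsection \<open>Expansion of eigenfunctions\<close>

text \<open>If \<open>p\<close> in the span is uniformly \<epsilon>-close to \<open>v\<close>, then
  \<integral> v^2 = \<integral> v (v - p) \<le> \<epsilon> \<integral> \<bar>v\<bar>. Letting
  \<epsilon> tend to 0 leaves a continuous nonnegative function with integral 0, which vanishes
  everywhere on a box with nonempty interior.\<close>

lemma eq_0_if_orthogonal_to_cos_basis:
  assumes v: "continuous_on Omega v" and orth: "\<And>m. integral Omega (\<lambda>z. v z * cos_basis m z) = 0"
    and z: "z \<in> Omega"
  shows "v z = 0"
proof -
  have span: "integral Omega (\<lambda>z. v z * p z) = 0" if "p \<in> cos_span" for p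
  proof -
    obtain F a where F: "finite F" "p = (\<lambda>z. \<Sum>m\<in>F. a m * cos_basis m z)"
      using \<open>p \<in> cos_span\<close> by (auto simp: cos_span_def)
    have "integral Omega (\<lambda>z. v z * p z) = integral Omega (\<lambda>z. \<Sum>m\<in>F. a m * (v z * cos_basis m z))"
      by (simp add: F(2) sum_distrib_left mult_ac)
    also have "\<dots> = (\<Sum>m\<in>F. integral Omega (\<lambda>z. a m * (v z * cos_basis m z)))"
      by (intro integral_sum F(1) integrable_on_Omega continuous_intros v continuous_on_cos_basis)
    also have "\<dots> = 0" by (simp add: orth)
    finally show ?thesis .
  qed
  let ?K = "integral Omega (\<lambda>z. \<bar>v z\<bar>)"
  have int: "(\<lambda>z. v z * v z) integrable_on Omega"
    by (intro integrable_on_Omega continuous_intros v)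
  have le: "integral Omega (\<lambda>z. v z * v z) \<le> \<epsilon> * ?K" if "\<epsilon> > 0" for \<epsilon>
  proof -
    obtain p where p: "p \<in> cos_span" "\<And>z. z \<in> Omega \<Longrightarrow> \<bar>v z - p z\<bar> < \<epsilon>"
      using cos_span_dense[OF v \<open>\<epsilon> > 0\<close>] by auto
    note cont = v continuous_on_cos_span[OF p(1)]
    have "integral Omega (\<lambda>z. v z * v z)
        = integral Omega (\<lambda>z. v z * (v z - p z)) + integral Omega (\<lambda>z. v z * p z)"
      by (subst integral_add[symmetric])
         (auto intro!: integrable_on_Omega continuous_intros cont simp: algebra_simps)
    also have "\<dots> = integral Omega (\<lambda>z. v z * (v z - p z))" by (simp add: span[OF p(1)])
    also have "\<dots> \<le> integral Omega (\<lambda>z. \<epsilon> * \<bar>v z\<bar>)"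
    proof (intro integral_le integrable_on_Omega continuous_intros cont)
      fix z assume "z \<in> Omega"
      have "v z * (v z - p z) \<le> \<bar>v z\<bar> * \<bar>v z - p z\<bar>" by (metis abs_ge_self abs_mult)
      also have "\<dots> \<le> \<bar>v z\<bar> * \<epsilon>"
        using p(2)[OF \<open>z \<in> Omega\<close>] by (intro mult_left_mono) auto
      finally show "v z * (v z - p z) \<le> \<epsilon> * \<bar>v z\<bar>" by (simp add: mult.commute)
    qed
    also have "\<dots> = \<epsilon> * ?K" by (rule integral_mult_right)
    finally show ?thesis .
  qed
  have "((\<lambda>\<epsilon>. \<epsilon> * ?K) \<longlongrightarrow> 0 * ?K) (at_right 0)" by (intro tendsto_intros)
  then have "integral Omega (\<lambda>z. v z * v z) \<le> 0 * ?K"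
    by (rule tendsto_lowerbound) (auto simp: eventually_at_right_field intro!: le exI[of _ 1])
  moreover have "integral Omega (\<lambda>z. v z * v z) \<ge> 0"
    by (intro integral_nonneg int) simp
  ultimately have "((\<lambda>z. v z * v z) has_integral 0) Omega"
    using int by (metis antisym integrable_integral mult_zero_left)
  moreover have "box (vector [-1, -1]) (vector [1, 1] :: real^2) \<noteq> {}"
    by (simp add: interval_ne_empty_cart forall_2)
  ultimately have "v z * v z = 0"
    using z v unfolding Omega_def
    by (intro has_integral_0_cbox_imp_0[of _ _ "\<lambda>z. v z * v z"] continuous_intros) auto
  then show ?thesis by simp
qed

text \<open>Green's identity is applied to \<Delta>u, using the third order condition, and then to
  u, using the first order one; each application moves one Laplacian onto the cosine product and
  yields a factor -\<lambda>_m.\<close>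

lemma solves_B_coefficient:
  assumes u: "solves_B Omega \<mu> u"
  shows "\<mu> * integral Omega (\<lambda>z. u z * cos_product m z)
    = (frequency_sq m)\<^sup>2 * integral Omega (\<lambda>z. u z * cos_product m z)"
proof -
  let ?I = "interior Omega" and ?w = "laplacian Omega u" and ?c = "cos_product m"
  note UI = unique_derivatives_open[OF open_interior]
  have C: "C_k 4 ?I u" "C_k 3 Omega u" using u by (auto simp: solves_B_def)
  have u_cont: "continuous_on Omega u" using C_k_antimono[of 0 3, OF _ C(2)] by simp
  have w1: "C_k 1 Omega ?w"
    by (rule C_k_laplacian[OF unique_derivatives_Omega]) (use C(2) in \<open>simp add: eval_nat_numeral\<close>)
  have "C_k 2 ?I (laplacian ?I u)"
    by (rule C_k_laplacian[OF UI]) (use C(1) in \<open>simp add: eval_nat_numeral\<close>)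
  then have w2: "C_k 2 ?I ?w"
    by (rule C_k_cong[rotated]) (rule laplacian_interior)
  have w_cont: "continuous_on Omega ?w" using C_k_antimono[OF _ w1, of 0] by simp
  have nu: "neumann u"
    using u C_k_antimono[OF _ C(1), of 2] C_k_antimono[OF _ C(2), of 1]
    by (simp add: neumann_def solves_B_def)
  have nw: "neumann ?w"
    using u w1 w2 unfolding neumann_def solves_B_def by blast
  have c_lap: "laplacian Omega ?c z = - frequency_sq m * ?c z" if "z \<in> ?I" for z
    using that interior_subset by (intro laplacian_cos_product unique_derivatives_Omega) blast
  have G_cont: "continuous_on Omega (\<lambda>z. - frequency_sq m * ?c z)"
    by (intro continuous_intros continuous_on_cos_product)
  have "\<mu> * integral Omega (\<lambda>z. u z * ?c z) = integral Omega (\<lambda>z. (\<mu> * u z) * ?c z)"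
    by (simp add: mult.assoc)
  also have "\<dots> = integral Omega (\<lambda>z. ?w z * (- frequency_sq m * ?c z))"
    by (rule green[OF nw neumann_cos_product _ _ G_cont c_lap])
       (use u u_cont in \<open>auto simp: solves_B_def bilaplacian_def intro!: continuous_intros\<close>)
  also have "\<dots> = integral Omega (\<lambda>z. - frequency_sq m * (?w z * ?c z))"
    by (simp add: mult_ac)
  also have "\<dots> = - frequency_sq m * integral Omega (\<lambda>z. ?w z * ?c z)"
    by (rule integral_mult_right)
  also have "integral Omega (\<lambda>z. ?w z * ?c z) = integral Omega (\<lambda>z. u z * (- frequency_sq m * ?c z))"
    by (rule green[OF nu neumann_cos_product w_cont refl G_cont c_lap])
  also have "\<dots> = integral Omega (\<lambda>z. - frequency_sq m * (u z * ?c z))"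
    by (simp add: mult_ac)
  also have "\<dots> = - frequency_sq m * integral Omega (\<lambda>z. u z * ?c z)"
    by (rule integral_mult_right)
  finally show ?thesis by (simp add: power2_eq_square)
qed

text \<open>Both indices are at most \<lambda>_m = sqrt \<mu>, because k \<le> k^2 \<le> (pi k /
  2)^2 for natural k and pi > 2.\<close>

lemma finite_frequency_sq: "finite {m. (frequency_sq m)\<^sup>2 = \<mu>}"
proof -
  obtain N where N: "sqrt \<mu> \<le> real N" using real_arch_simple by blast
  have "fst m \<le> N \<and> snd m \<le> N" if "(frequency_sq m)\<^sup>2 = \<mu>" for m
  proof -
    have "frequency_sq m = sqrt \<mu>"
      using that by (simp add: frequency_sq_def flip: that)
    have sq: "real k \<le> (pi * real k / 2)\<^sup>2" for k
    proof -
      have "real k \<le> (real k)\<^sup>2" by (cases k) (auto simp: power2_eq_square)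
      also have "\<dots> \<le> (pi * real k / 2)\<^sup>2"
        using pi_gt3 mult_right_mono[of 2 pi "real k"] by (intro power_mono) auto
      finally show ?thesis .
    qed
    have "real (fst m) \<le> frequency_sq m" "real (snd m) \<le> frequency_sq m"
      using sq[of "fst m"] sq[of "snd m"] zero_le_power2[of "pi * real (fst m) / 2"]
        zero_le_power2[of "pi * real (snd m) / 2"] unfolding frequency_sq_def by linarith+
    then show ?thesis using N \<open>frequency_sq m = sqrt \<mu>\<close> by linarith
  qed
  then have "{m. (frequency_sq m)\<^sup>2 = \<mu>} \<subseteq> {..N} \<times> {..N}" by force
  then show ?thesis by (rule finite_subset) simp
qed

lemma solves_B_cos_basis: "solves_B Omega ((frequency_sq m)\<^sup>2) (cos_basis m)"
  unfolding cos_basis_def[abs_def]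
  by (rule solves_B_cmult[OF unique_derivatives_Omega _ solves_B_cos_product]) (simp add: Omega_def closed_cbox)

lemma eigenfunction_A_cos_basis: "eigenfunction_A Omega ((frequency_sq m)\<^sup>2) (cos_basis m)"
proof -
  \<comment> \<open>At this corner both cosines have argument 0, hence value 1.\<close>
  have "cos_basis m (vector [-1, -1]) \<noteq> 0"
    using cos_const_sq(2)[of m] by (simp add: cos_basis_def cos_product_def)
  moreover have "vector [-1, -1] \<in> Omega" by (simp add: Omega_iff forall_2)
  ultimately show ?thesis
    using solves_B_cos_basis by (auto simp: eigenfunction_A_def solves_A_iff_solves_B)
qed

text \<open>The difference of \<open>u\<close> and the sum is orthogonal to every basis function:
  for indices in \<open>F\<close> by orthonormality, for the others because \<mu> \<noteq>
  \<lambda>_n^2 forces the coefficient to vanish. Continuity makes the equality pointwise.\<close>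

lemma solves_B_expansion:
  assumes u: "solves_B Omega \<mu> u" and z: "z \<in> Omega"
  defines "F \<equiv> {m. (frequency_sq m)\<^sup>2 = \<mu>}"
    and "a \<equiv> \<lambda>m. integral Omega (\<lambda>z. u z * cos_basis m z)"
  shows "u z = (\<Sum>m\<in>F. a m * cos_basis m z)"
proof -
  have F: "finite F" unfolding F_def by (rule finite_frequency_sq)
  have u_cont: "continuous_on Omega u"
    using u C_k_antimono[of 0 3 Omega u] by (simp add: solves_B_def)
  have orthonormal: "integral Omega (\<lambda>z. cos_basis m z * cos_basis n z) = (if m = n then 1 else 0)" for m n
    using L2_inner_cos_basis[of m n]
    by (simp add: L2_inner_eq_integral continuous_on_cos_basis)
  have a0: "a n = 0" if "n \<notin> F" for n
  proof -
    have "a n = integral Omega (\<lambda>z. cos_const n * (u z * cos_product n z))"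
      by (simp add: a_def cos_basis_def mult_ac)
    also have "\<dots> = cos_const n * integral Omega (\<lambda>z. u z * cos_product n z)"
      by (rule integral_mult_right)
    also have "\<dots> = 0"
      using solves_B_coefficient[OF u, of n] that by (simp add: F_def)
    finally show ?thesis .
  qed
  have "u z - (\<Sum>m\<in>F. a m * cos_basis m z) = 0"
  proof (rule eq_0_if_orthogonal_to_cos_basis[OF _ _ z])
    show "continuous_on Omega (\<lambda>z. u z - (\<Sum>m\<in>F. a m * cos_basis m z))"
      by (intro continuous_intros u_cont continuous_on_cos_basis)
    fix n
    have "integral Omega (\<lambda>z. (u z - (\<Sum>m\<in>F. a m * cos_basis m z)) * cos_basis n z)
        = integral Omega (\<lambda>z. u z * cos_basis n z - (\<Sum>m\<in>F. a m * (cos_basis m z * cos_basis n z)))"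
      by (simp add: left_diff_distrib sum_distrib_right mult.assoc)
    also have "\<dots> = a n - integral Omega (\<lambda>z. \<Sum>m\<in>F. a m * (cos_basis m z * cos_basis n z))"
      unfolding a_def
      by (intro integral_diff integrable_on_Omega continuous_intros u_cont continuous_on_cos_basis)
    also have "integral Omega (\<lambda>z. \<Sum>m\<in>F. a m * (cos_basis m z * cos_basis n z))
        = (\<Sum>m\<in>F. integral Omega (\<lambda>z. a m * (cos_basis m z * cos_basis n z)))"
      by (intro integral_sum F integrable_on_Omega continuous_intros continuous_on_cos_basis)
    also have "\<dots> = (\<Sum>m\<in>F. if m = n then a m else 0)"
      by (intro sum.cong refl) (simp add: orthonormal)
    also have "a n - \<dots> = 0"
      using F a0[of n] by (simp add: sum.delta)
    finally show "integral Omega (\<lambda>z. (u z - (\<Sum>m\<in>F. a m * cos_basis m z)) * cos_basis n z) = 0" .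
  qed
  then show ?thesis by simp
qed

text \<open>That the zero function is a solution is the base case of the induction; a caller gets it
  as 0 times any solution.\<close>

lemma solves_B_sum:
  assumes "unique_derivatives S" "closed S" "solves_B S \<mu> (\<lambda>z. 0)"
    and "finite F" "\<And>m. m \<in> F \<Longrightarrow> solves_B S \<mu> (f m)"
  shows "solves_B S \<mu> (\<lambda>z. \<Sum>m\<in>F. f m z)"
  using assms(4,5)
proof (induction F rule: finite_induct)
  case (insert x F)
  then show ?case
    using solves_B_add[OF assms(1,2), of \<mu> "f x" "\<lambda>z. \<Sum>m\<in>F. f m z"] by simp
qed (simp add: assms(3))

text \<open>The form allows for multiplicity: different m, such as swapped pairs, may share an
  eigenvalue, so an eigenspace consists of combinations of basis functions with the same \<mu>.
  Orthonormality and density account for the word basis.\<close>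

theorem theorem4p5:
  shows "(\<forall>\<mu> u. eigenfunction_A Omega \<mu> u \<longleftrightarrow> eigenfunction_B Omega \<mu> u)
    \<and> (\<forall>m. \<exists>\<mu>. eigenfunction_A Omega \<mu> (cos_basis m))
    \<and> (\<forall>\<mu> u. eigenfunction_A Omega \<mu> u \<longleftrightarrow>
           (\<exists>z\<in>Omega. u z \<noteq> 0) \<and>
           (\<exists>F a. finite F \<and> (\<forall>m\<in>F. eigenfunction_A Omega \<mu> (cos_basis m)) \<and>
              (\<forall>z\<in>Omega. u z = (\<Sum>m\<in>F. a m * cos_basis m z))))
    \<and> orthonormal_basis Omega cos_basis"
proof (intro conjI allI)
  show "eigenfunction_A Omega \<mu> u \<longleftrightarrow> eigenfunction_B Omega \<mu> u" for \<mu> u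
    by (simp add: eigenfunction_A_def eigenfunction_B_def solves_A_iff_solves_B)
  show "\<exists>\<mu>. eigenfunction_A Omega \<mu> (cos_basis m)" for m
    using eigenfunction_A_cos_basis by blast
  show "orthonormal_basis Omega cos_basis"
    unfolding orthonormal_basis_def
    using square_integrable_continuous[OF continuous_on_cos_basis] L2_inner_cos_basis cos_basis_dense
    by blast
  fix \<mu> u
  show "eigenfunction_A Omega \<mu> u \<longleftrightarrow>
      (\<exists>z\<in>Omega. u z \<noteq> 0) \<and>
      (\<exists>F a. finite F \<and> (\<forall>m\<in>F. eigenfunction_A Omega \<mu> (cos_basis m)) \<and>
        (\<forall>z\<in>Omega. u z = (\<Sum>m\<in>F. a m * cos_basis m z)))" (is "?L \<longleftrightarrow> ?nz \<and> ?R")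
  proof
    assume ?L
    then have nz: ?nz and u: "solves_B Omega \<mu> u"
      by (auto simp: eigenfunction_A_def solves_A_iff_solves_B)
    moreover have ?R
    proof (intro exI conjI ballI)
      show "finite {m. (frequency_sq m)\<^sup>2 = \<mu>}" by (rule finite_frequency_sq)
      show "eigenfunction_A Omega \<mu> (cos_basis m)" if "m \<in> {m. (frequency_sq m)\<^sup>2 = \<mu>}" for m
        using that eigenfunction_A_cos_basis[of m] by simp
      show "u z = (\<Sum>m\<in>{m. (frequency_sq m)\<^sup>2 = \<mu>}.
          integral Omega (\<lambda>z. u z * cos_basis m z) * cos_basis m z)" if "z \<in> Omega" for z
        by (rule solves_B_expansion[OF u that])
    qed
    ultimately show "?nz \<and> ?R" by blast
  next
    assume R: "?nz \<and> ?R"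
    then obtain F a where F: "finite F" "\<And>m. m \<in> F \<Longrightarrow> solves_B Omega \<mu> (cos_basis m)"
      and u: "\<And>z. z \<in> Omega \<Longrightarrow> u z = (\<Sum>m\<in>F. a m * cos_basis m z)"
      by (auto simp: eigenfunction_A_def solves_A_iff_solves_B)
    have "closed Omega" by (simp add: Omega_def closed_cbox)
    note cmult = solves_B_cmult[OF unique_derivatives_Omega this]
      and sum = solves_B_sum[OF unique_derivatives_Omega this]
    \<comment> \<open>A nonzero \<open>u\<close> excludes the empty sum, so some basis function with
      eigenvalue \<mu> is available to produce the zero solution.\<close>
    have "F \<noteq> {}" using R u by auto
    then obtain m where "m \<in> F" by blast
    from cmult[OF F(2)[OF this], of 0] have "solves_B Omega \<mu> (\<lambda>z. 0)" by simp
    from sum[OF this F(1) cmult[OF F(2)]]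
    have "solves_B Omega \<mu> (\<lambda>z. \<Sum>m\<in>F. a m * cos_basis m z)" .
    then have "solves_B Omega \<mu> u"
      by (rule solves_B_cong[rotated]) (simp_all add: u \<open>closed Omega\<close>)
    then show ?L using R by (simp add: eigenfunction_A_def solves_A_iff_solves_B)
  qed
qed

end
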